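(* Consider a linear network with $L\ge2$ links of capacity $1$ in the quasi-stationary regime and assume $\rho_k<1$ for $2\le k\le L$. Then: 1. The set $\{\tilde\pi^\alpha_\beta:\ \alpha\in[0,1],\ \beta\in\{1,2,\dots\}\}$ of probability measures on $\mathbb{R}_+^{L-1}$ is tight. 2. For any $\alpha\in[0,1]$, the stationary distribution $\tilde\pi^\alpha_\beta$ converges in distribution to the Dirac measure $\delta_{\gamma(\alpha)}$ as $\beta\to+\infty$, where $\gamma(\alpha)=(\gamma_2(\alpha),\dots,\gamma_L(\alpha))$ with $$\gamma_k(\alpha)=\max\Big(\rho_k,\ \frac{\rho_k}{1-\rho_k}\min\big(\alpha,\min_{2\le j\le k-1}(1-\rho_j)\big)\Big),\qquad 2\le k\le L.$$ 3. If $$\bar\phi_{0,\beta}(\alpha)=\int_{\mathbb{R}_+^{L-1}}\tilde\psi_0(\alpha,x_{2:L})\,\tilde\pi^\alpha_\beta(\mathrm{d}x_{2:L}),\qquad\alpha\in[0,1],$$ then, as $\beta\to+\infty$, $\bar\phi_{0,\beta}$ converges pointwise on $[0,1]$ to $$\bar\phi_{0,\infty}:\alpha\mapsto\min\Big(\alpha,\min_{2\le k\le L}(1-\rho_k)\Big).$$ 4. For all $\alpha\in[0,1]$, $\displaystyle\lim_{\beta\to+\infty}\inf_{\alpha\le u\le1}\bar\phi_{0,\beta}(u)=\bar\phi_{0,\infty}(\alpha)$.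
   Context: Setting: parameters $\lambda_k,\mu_k,a_k>0$ for $2\le k\le L$ are given, with $\rho_k=\lambda_k/\mu_k$. (They are the arrival rates, inverse mean sizes and access rates of classes $2,\dots,L$ in a linear network, in which class $0$ crosses links $1,\dots,L$ in order and class $k$ uses link $k$ only; in the quasi-stationary regime the rate of class $0$ after link $1$ is fixed equal to $\alpha\in[0,1]$.) For $\alpha\in[0,1]$ and $x_{2:L}=(x_2,\dots,x_L)\in\mathbb{R}_+^{L-1}$ let $\tilde\theta_0^1(\alpha,x_{2:L})=\alpha$ and, for $2\le k\le L$, $$\tilde\theta_0^k=\min\Big(\tilde\theta_0^{k-1},\tfrac{\tilde\theta_0^{k-1}}{\tilde\theta_0^{k-1}+x_k}\Big),\quad \tilde\psi_k(\alpha,x_{2:L})=\min\Big(x_k,\tfrac{x_k}{\tilde\theta_0^{k-1}+x_k}\Big),\quad \tilde\psi_0(\alpha,x_{2:L})=\tilde\theta_0^L(\alpha,x_{2:L})$$ (each minimum is $0$ when its denominator is $0$). For an integer $\beta\ge1$ let $(\tilde N^\alpha_{2:L,\beta}(t))$ be the Markov jump process on $\mathbb{N}^{L-1}$ in which, for $2\le k\le L$, $n_k\to n_k+1$ at rate $\beta\lambda_k$ and $n_k\to n_k-1$ at rate $\beta\mu_k\tilde\psi_k(\alpha,(\beta^{-1}a_2n_2,\dots,\beta^{-1}a_Ln_L))$. When $\rho_k<1$ for $2\le k\le L$ this process is ergodic, and $\tilde\pi^\alpha_\beta$ denotes the stationary distribution of the rescaled process whose coordinates are $\beta^{-1}a_k\tilde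 N^\alpha_{k,\beta}(t)$, $2\le k\le L$. A minimum over an empty index set is $+\infty$. *)

theory Defs
  imports "HOL-Probability.Probability"
begin

(* Vectors indexed by the classes 2,...,L are functions on nat that vanish off {2..L}.
   With the product topology and its Borel sets, orthant L is (homeomorphic to) R_+^(L-1). *)

definition orthant :: "nat \<Rightarrow> (nat \<Rightarrow> real) set" where
  "orthant L = {x. (\<forall>k\<in>{2..L}. 0 \<le> x k) \<and> (\<forall>k. k \<notin> {2..L} \<longrightarrow> x k = 0)}"

definition states :: "nat \<Rightarrow> (nat \<Rightarrow> nat) set" where
  "states L = {n. \<forall>k. k \<notin> {2..L} \<longrightarrow> n k = 0}"

(* Index 0 is junk. For nonnegative arguments a denominator vanishes only if both of its
   summands do; then t / 0 = 0 makes the minimum 0. The same applies to psi. *)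
fun theta0 :: "real \<Rightarrow> (nat \<Rightarrow> real) \<Rightarrow> nat \<Rightarrow> real" where
  "theta0 \<alpha> x 0 = \<alpha>"
| "theta0 \<alpha> x (Suc 0) = \<alpha>"
| "theta0 \<alpha> x (Suc (Suc j)) =
     min (theta0 \<alpha> x (Suc j))
         (theta0 \<alpha> x (Suc j) / (theta0 \<alpha> x (Suc j) + x (Suc (Suc j))))"

definition psi :: "real \<Rightarrow> (nat \<Rightarrow> real) \<Rightarrow> nat \<Rightarrow> real" where
  "psi \<alpha> x k = min (x k) (x k / (theta0 \<alpha> x (k - 1) + x k))"

definition psi0 :: "nat \<Rightarrow> real \<Rightarrow> (nat \<Rightarrow> real) \<Rightarrow> real" where
  "psi0 L \<alpha> x = theta0 \<alpha> x L"

definition rescale :: "nat \<Rightarrow> (nat \<Rightarrow> real) \<Rightarrow> nat \<Rightarrow> (nat \<Rightarrow> nat) \<Rightarrow> (nat \<Rightarrow> real)" where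
  "rescale L a \<beta> n = (\<lambda>k. if k \<in> {2..L} then a k * real (n k) / real \<beta> else 0)"

definition jump_rate ::
  "nat \<Rightarrow> (nat \<Rightarrow> real) \<Rightarrow> (nat \<Rightarrow> real) \<Rightarrow> (nat \<Rightarrow> real) \<Rightarrow> real \<Rightarrow> nat
     \<Rightarrow> (nat \<Rightarrow> nat) \<Rightarrow> (nat \<Rightarrow> nat) \<Rightarrow> real" where
  "jump_rate L lam mu a \<alpha> \<beta> n m =
     (\<Sum>k=2..L.
        (if m = n(k := n k + 1) then real \<beta> * lam k else 0) +
        (if 0 < n k \<and> m = n(k := n k - 1)
         then real \<beta> * mu k * psi \<alpha> (rescale L a \<beta> n) k else 0))"

(* P t n is the law at time t, started from n, of a Markov jump process on S with rate
   q n m from n to m (m \<noteq> n): a Markov semigroup on S whose derivative at 0 is the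
   conservative generator with off-diagonal entries q. When the total rates are bounded,
   as for jump_rate, P is determined on S by q. *)
definition jump_semigroup ::
  "'s set \<Rightarrow> ('s \<Rightarrow> 's \<Rightarrow> real) \<Rightarrow> (real \<Rightarrow> 's \<Rightarrow> 's pmf) \<Rightarrow> bool" where
  "jump_semigroup S q P \<longleftrightarrow>
     (\<forall>t\<ge>0. \<forall>n\<in>S. set_pmf (P t n) \<subseteq> S) \<and>
     (\<forall>n\<in>S. P 0 n = return_pmf n) \<and>
     (\<forall>s\<ge>0. \<forall>t\<ge>0. \<forall>n\<in>S. P (s + t) n = bind_pmf (P s n) (P t)) \<and>
     (\<forall>n\<in>S. \<forall>m\<in>S - {n}. ((\<lambda>t. pmf (P t n) m / t) \<longlongrightarrow> q n m) (at_right 0)) \<and>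
     (\<forall>n\<in>S. ((\<lambda>t. (1 - pmf (P t n) n) / t) \<longlongrightarrow> (\<Sum>\<^sub>\<infinity>m\<in>S - {n}. q n m)) (at_right 0))"

definition stationary_distribution ::
  "'s set \<Rightarrow> (real \<Rightarrow> 's \<Rightarrow> 's pmf) \<Rightarrow> 's pmf \<Rightarrow> bool" where
  "stationary_distribution S P p \<longleftrightarrow>
     set_pmf p \<subseteq> S \<and> (\<forall>t\<ge>0. bind_pmf p (P t) = p)"

definition rescaled_law ::
  "nat \<Rightarrow> (nat \<Rightarrow> real) \<Rightarrow> nat \<Rightarrow> (nat \<Rightarrow> nat) pmf \<Rightarrow> (nat \<Rightarrow> real) measure" where
  "rescaled_law L a \<beta> p =
     distr (measure_pmf p) (restrict_space borel (orthant L)) (rescale L a \<beta>)"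

(* The library's tight and weak_conv_m only cover measures on the real line. Both notions
   below are meant for probability measures M on restrict_space borel X. *)

definition tight_on :: "'a::t2_space set \<Rightarrow> 'a measure set \<Rightarrow> bool" where
  "tight_on X Ms \<longleftrightarrow>
     (\<forall>\<epsilon>>0. \<exists>K\<subseteq>X. compact K \<and> (\<forall>M\<in>Ms. measure M (X - K) \<le> \<epsilon>))"

definition weak_conv_on ::
  "'a::t2_space set \<Rightarrow> (nat \<Rightarrow> 'a measure) \<Rightarrow> 'a measure \<Rightarrow> bool" where
  "weak_conv_on X Ms M \<longleftrightarrow>
     (\<forall>f::'a \<Rightarrow> real. continuous_on X f \<and> bounded (f ` X) \<longrightarrow>
        (\<lambda>n. integral\<^sup>L (Ms n) f) \<longlonglongrightarrow> integral\<^sup>L M f)"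

(* Inserting \<alpha> before taking Min accounts for the empty minimum being +infinity. *)
definition gamma_lim :: "nat \<Rightarrow> (nat \<Rightarrow> real) \<Rightarrow> real \<Rightarrow> nat \<Rightarrow> real" where
  "gamma_lim L \<rho> \<alpha> = (\<lambda>k. if k \<in> {2..L}
     then max (\<rho> k) (\<rho> k / (1 - \<rho> k) * Min (insert \<alpha> ((\<lambda>j. 1 - \<rho> j) ` {2..<k})))
     else 0)"

definition phi_bar ::
  "nat \<Rightarrow> (nat \<Rightarrow> real) \<Rightarrow> (real \<Rightarrow> nat \<Rightarrow> (nat \<Rightarrow> nat) pmf) \<Rightarrow> nat \<Rightarrow> real \<Rightarrow> real" where
  "phi_bar L a p \<beta> \<alpha> = (\<integral>x. psi0 L \<alpha> x \<partial>rescaled_law L a \<beta> (p \<alpha> \<beta>))"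

definition phi_lim :: "nat \<Rightarrow> (nat \<Rightarrow> real) \<Rightarrow> real \<Rightarrow> real" where
  "phi_lim L \<rho> \<alpha> = Min (insert \<alpha> ((\<lambda>k. 1 - \<rho> k) ` {2..L}))"

end

theory Submission imports Defs "HOL-Real_Asymp.Real_Asymp" begin

text \<open>
  Write \<open>x\<^sub>k\<close> for the rescaled number of flows of class \<open>k\<close>, \<open>\<theta>\<^sub>k\<close> for the rate of class 0 behind
  link \<open>k\<close>, \<open>c\<^sub>k\<close> for the candidate limit \<open>phi_lim k\<close> of \<open>\<theta>\<^sub>k\<close>, and \<open>\<gamma>\<^sub>k\<close> for that of \<open>x\<^sub>k\<close>.
  The link \<open>k\<close> sees the links in front of it through the single number \<open>\<theta>\<^sub>k\<^sub>-\<^sub>1 \<in> [0, 1]\<close> only. If that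
  number were the constant \<open>c\<close>, the drift of \<open>x\<^sub>k\<close> would be proportional to the difference between
  \<open>\<rho>\<^sub>k\<close> and the nondecreasing function \<open>share c\<close> of \<open>x\<^sub>k\<close>, whose unique balance point is \<open>\<gamma>\<^sub>k\<close>; the
  noise has variance of order \<open>1/\<beta>\<close>. So \<open>x\<^sub>k\<close> should concentrate at \<open>\<gamma>\<^sub>k\<close>, and then \<open>\<theta>\<^sub>k = share x\<^sub>k \<theta>\<^sub>k\<^sub>-\<^sub>1\<close> at
  \<open>share \<gamma>\<^sub>k c\<^sub>k\<^sub>-\<^sub>1 = c\<^sub>k\<close>, which is an induction along the links.

  All of this can be done with one test function. Under a stationary law the generator of a bounded
  function has mean 0 (\<open>stationary_generator_eq_0\<close>). Applied to a truncation of \<open>(x\<^sub>k - \<gamma>\<^sub>k)\<^sup>2\<close> it bounds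
  the mean of \<open>(x\<^sub>k - \<gamma>\<^sub>k) (\<mu>\<^sub>k \<psi>\<^sub>k - \<lambda>\<^sub>k)\<close> by a term of order \<open>1/\<beta>\<close> (\<open>truncated_drift_le_0\<close>).
  Two facts on \<open>share\<close> make this useful. Replacing \<open>\<theta>\<^sub>k\<^sub>-\<^sub>1\<close> by \<open>c\<^sub>k\<^sub>-\<^sub>1\<close> costs at most a multiple of
  \<open>\<bar>\<theta>\<^sub>k\<^sub>-\<^sub>1 - c\<^sub>k\<^sub>-\<^sub>1\<bar>\<close> even after multiplication by the unbounded factor \<open>x\<^sub>k\<close>
  (\<open>share_lipschitz_weighted\<close>), and the remaining product dominates
  \<open>(1 - \<rho>\<^sub>k) (x\<^sub>k - \<gamma>\<^sub>k)\<^sup>2 / (1 + x\<^sub>k)\<close> (\<open>share_coercive\<close>). Hence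
  \<open>E (x\<^sub>k - \<gamma>\<^sub>k)\<^sup>2 / (1 + x\<^sub>k) \<le> const (1/\<beta> + E \<bar>\<theta>\<^sub>k\<^sub>-\<^sub>1 - c\<^sub>k\<^sub>-\<^sub>1\<bar>)\<close> (\<open>weighted_dev_mean_le\<close>).

  The constants do not depend on \<open>\<alpha>\<close>. Since \<open>\<bar>\<theta>\<^sub>k\<^sub>-\<^sub>1 - c\<^sub>k\<^sub>-\<^sub>1\<bar> \<le> 1\<close>, this bounds the means \<open>E x\<^sub>k\<close>, which is
  tightness by the inequality of Markov. Along the links it gives \<open>E \<bar>x\<^sub>k - \<gamma>\<^sub>k\<bar> \<rightarrow> 0\<close> and
  \<open>E \<bar>\<theta>\<^sub>k - c\<^sub>k\<bar> \<rightarrow> 0\<close>, both uniformly in \<open>\<alpha>\<close>; the former yields the convergence to the Dirac measure,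
  the latter for \<open>k = L\<close> the uniform convergence of the mean rates. As the limit is monotone in \<open>\<alpha>\<close>,
  uniform convergence carries over to the infima over \<open>[\<alpha>, 1]\<close>.
\<close>

section \<open>Stationary distributions of jump semigroups\<close>

lemma expectation_bind_pmf:
  fixes f :: "'b \<Rightarrow> real"
  assumes "\<And>x. \<bar>f x\<bar> \<le> B"
  shows "measure_pmf.expectation (bind_pmf p K) f
    = measure_pmf.expectation p (\<lambda>x. measure_pmf.expectation (K x) f)"
  unfolding measure_pmf_bind
  by (rule integral_bind[where K="count_space UNIV" and B=B and B'=1])
     (use assms measurable_measure_pmf[of K] in \<open>auto simp: measure_pmf.emeasure_space_1 measurable_def\<close>)

lemma bounded_integrable_pmf:
  fixes f :: "'a \<Rightarrow> real"
  assumes "\<And>x. x \<in> set_pmf p \<Longrightarrow> \<bar>f x\<bar> \<le> B"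
  shows "integrable (measure_pmf p) f"
  by (rule measure_pmf.integrable_const_bound[where B=B]) (auto simp: AE_measure_pmf_iff assms)

text \<open>For \<open>w\<close> the law of the process after a short time from \<open>n\<close>: all mass outside the listed
targets \<open>A\<close> enters the expectation with weight at most \<open>2 * B\<close>. With \<open>A\<close> empty this controls the
increment by the probability of having left \<open>n\<close>, which is the domination needed below; with \<open>A\<close> the
set of all possible jumps the error is of smaller order than the time.\<close>

lemma expectation_few_jumps:
  fixes f :: "'a \<Rightarrow> real"
  assumes B: "\<And>m. \<bar>f m\<bar> \<le> B" and A: "finite A" "n \<notin> A"
  shows "\<bar>measure_pmf.expectation w f - f n - (\<Sum>m\<in>A. pmf w m * (f m - f n))\<bar>
    \<le> 2 * B * (1 - pmf w n - (\<Sum>m\<in>A. pmf w m))"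
proof -
  let ?I = "indicator (insert n A) :: 'a \<Rightarrow> real" and ?J = "indicator (- insert n A) :: 'a \<Rightarrow> real"
  have B2: "\<bar>f m - f n\<bar> \<le> 2 * B" for m
    using B[of m] B[of n] by linarith
  have B0: "0 \<le> B" using B[of n] by linarith
  have B3: "\<bar>f m\<bar> \<le> 2 * B" for m using B[of m] B0 by linarith
  have int: "integrable (measure_pmf w) f" "integrable (measure_pmf w) (\<lambda>m. (f m - f n) * ?I m)"
     "integrable (measure_pmf w) (\<lambda>m. (f m - f n) * ?J m)"
    using B0 B2 B3
    by (auto intro!: bounded_integrable_pmf[where B="2*B"] simp: indicator_def)
  have intJ: "integrable (measure_pmf w) (\<lambda>m. 2 * B * ?J m)"
    by (intro integrable_mult_right bounded_integrable_pmf[where B=1]) (simp add: indicator_def)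
  have "measure_pmf.expectation w f - f n = measure_pmf.expectation w (\<lambda>m. f m - f n)"
    using int by simp
  also have "\<dots> = measure_pmf.expectation w (\<lambda>m. (f m - f n) * ?I m + (f m - f n) * ?J m)"
    by (intro Bochner_Integration.integral_cong) (auto simp: indicator_def)
  also have "\<dots> = measure_pmf.expectation w (\<lambda>m. (f m - f n) * ?I m)
      + measure_pmf.expectation w (\<lambda>m. (f m - f n) * ?J m)"
    using int by (intro Bochner_Integration.integral_add)
  also have "measure_pmf.expectation w (\<lambda>m. (f m - f n) * ?I m)
      = (\<Sum>m\<in>insert n A. (f m - f n) * ?I m * pmf w m)"
    using A by (intro integral_measure_pmf_real) (auto simp: indicator_def split: if_splits)
  also have "\<dots> = (\<Sum>m\<in>A. pmf w m * (f m - f n))"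
    using A by (auto intro!: sum.cong)
  finally have "\<bar>measure_pmf.expectation w f - f n - (\<Sum>m\<in>A. pmf w m * (f m - f n))\<bar>
      = \<bar>measure_pmf.expectation w (\<lambda>m. (f m - f n) * ?J m)\<bar>" by simp
  also have "\<dots> \<le> measure_pmf.expectation w (\<lambda>m. \<bar>(f m - f n) * ?J m\<bar>)"
    by (rule integral_abs_bound)
  also have "\<dots> \<le> measure_pmf.expectation w (\<lambda>m. 2 * B * ?J m)"
    using B2 int intJ by (intro integral_mono) (auto simp: indicator_def)
  also have "\<dots> = 2 * B * measure_pmf.prob w (- insert n A)"
    by simp
  also have "measure_pmf.prob w (- insert n A) = 1 - measure_pmf.prob w (insert n A)"
    using measure_pmf.prob_compl[of "insert n A" w] by (simp add: Compl_eq_Diff_UNIV)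
  also have "measure_pmf.prob w (insert n A) = pmf w n + (\<Sum>m\<in>A. pmf w m)"
    using A by (simp add: measure_measure_pmf_finite)
  finally show ?thesis by (simp add: algebra_simps)
qed

text \<open>Being at \<open>n\<close> at all multiples of \<open>t\<close> up to \<open>i * t\<close> is one way to be at \<open>n\<close> at time \<open>i * t\<close>.\<close>

lemma jump_semigroup_stay_pow:
  assumes P: "jump_semigroup S q P" and n: "n \<in> S" and t: "0 \<le> t"
  shows "pmf (P t n) n ^ i \<le> pmf (P (real i * t) n) n"
proof (induction i)
  case 0
  then show ?case using P n by (simp add: jump_semigroup_def)
next
  case (Suc i)
  have "P (t + real i * t) n = bind_pmf (P t n) (P (real i * t))"
    using P n t by (simp add: jump_semigroup_def)
  then have "pmf (P (real (Suc i) * t) n) n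
      = measure_pmf.expectation (P t n) (\<lambda>m. pmf (P (real i * t) m) n)"
    by (simp add: pmf_bind algebra_simps)
  also have "\<dots> \<ge> measure_pmf.expectation (P t n) (\<lambda>m. indicator {n} m * pmf (P (real i * t) n) n)"
    by (intro integral_mono bounded_integrable_pmf[where B=1])
       (auto simp: indicator_def pmf_le_1)
  also have "measure_pmf.expectation (P t n) (\<lambda>m. indicator {n} m * pmf (P (real i * t) n) n)
      = pmf (P t n) n * pmf (P (real i * t) n) n"
    by (subst integral_measure_pmf_real[where A="{n}"]) (auto simp: indicator_def split: if_splits)
  also have "\<dots> \<ge> pmf (P t n) n * pmf (P t n) n ^ i"
    using Suc by (intro mult_left_mono) auto
  finally show ?case by simp
qed

text \<open>Cut \<open>[0, t]\<close> into equal pieces, bound the power in \<open>jump_semigroup_stay_pow\<close> below by the Bernoulli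
inequality, and refine. The derivative at 0 thus bounds the probability of having left for every \<open>t\<close>,
which provides a dominating constant.\<close>

lemma jump_semigroup_leave_le:
  assumes P: "jump_semigroup S q P" and n: "n \<in> S" and t: "0 < t"
  shows "1 - pmf (P t n) n \<le> t * (\<Sum>\<^sub>\<infinity>m\<in>S - {n}. q n m)"
proof -
  define r where "r s = (1 - pmf (P s n) n) / s" for s
  let ?s = "\<lambda>i. t / real (Suc i)"
  have s0: "filterlim ?s (at_right 0) sequentially"
    using t by real_asymp
  have "(r \<longlongrightarrow> (\<Sum>\<^sub>\<infinity>m\<in>S - {n}. q n m)) (at_right 0)"
    using P n unfolding r_def jump_semigroup_def by blast
  then have "(\<lambda>i. t * r (?s i)) \<longlonglongrightarrow> t * (\<Sum>\<^sub>\<infinity>m\<in>S - {n}. q n m)"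
    by (intro tendsto_mult_left filterlim_compose[OF _ s0])
  moreover have "1 - pmf (P t n) n \<le> t * r (?s i)" for i
  proof -
    let ?k = "Suc i"
    have "1 + real ?k * (pmf (P (?s i) n) n - 1) \<le> (1 + (pmf (P (?s i) n) n - 1)) ^ ?k"
      by (rule Bernoulli_inequality) simp
    also have "\<dots> \<le> pmf (P (real ?k * ?s i) n) n"
      using jump_semigroup_stay_pow[OF P n, of "?s i" ?k] t by simp
    also have "real ?k * ?s i = t" by simp
    finally have *: "1 + real ?k * (pmf (P (?s i) n) n - 1) \<le> pmf (P t n) n" .
    have "t * r (?s i) = real ?k * (1 - pmf (P (?s i) n) n)"
      using t by (simp add: r_def)
    also have "\<dots> = - (real ?k * (pmf (P (?s i) n) n - 1))"
      by (metis minus_diff_eq mult_minus_right)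
    finally show ?thesis using * by linarith
  qed
  ultimately show ?thesis
    by (intro LIMSEQ_le_const) auto
qed

text \<open>Only entrywise derivatives of the semigroup are given. They suffice because the total rate of leaving
\<open>n\<close> converges to the sum of the entrywise rates on \<open>F\<close>, so the mass that goes
elsewhere is of smaller order than \<open>t\<close>.\<close>

lemma jump_semigroup_generator:
  fixes f :: "'s \<Rightarrow> real"
  assumes P: "jump_semigroup S q P" and n: "n \<in> S" and B: "\<And>m. \<bar>f m\<bar> \<le> B"
    and F: "finite F" "F \<subseteq> S - {n}" "\<And>m. m \<in> S - {n} - F \<Longrightarrow> q n m = 0"
  shows "((\<lambda>t. (measure_pmf.expectation (P t n) f - f n) / t)
    \<longlongrightarrow> (\<Sum>m\<in>F. q n m * (f m - f n))) (at_right 0)"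
proof -
  let ?E = "\<lambda>t. measure_pmf.expectation (P t n) f"
  let ?X = "\<lambda>t. \<Sum>m\<in>F. pmf (P t n) m / t * (f m - f n)"
  let ?Y = "\<lambda>t. (1 - pmf (P t n) n) / t - (\<Sum>m\<in>F. pmf (P t n) m / t)"
  have q: "((\<lambda>t. pmf (P t n) m / t) \<longlongrightarrow> q n m) (at_right 0)" if "m \<in> F" for m
    using P n F(2) that unfolding jump_semigroup_def by blast
  have "((\<lambda>t. (1 - pmf (P t n) n) / t) \<longlongrightarrow> (\<Sum>\<^sub>\<infinity>m\<in>S - {n}. q n m)) (at_right 0)"
    using P n unfolding jump_semigroup_def by blast
  also have "(\<Sum>\<^sub>\<infinity>m\<in>S - {n}. q n m) = (\<Sum>\<^sub>\<infinity>m\<in>F. q n m)"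
    using F by (intro infsum_cong_neutral) auto
  finally have "(?Y \<longlongrightarrow> (\<Sum>m\<in>F. q n m) - (\<Sum>m\<in>F. q n m)) (at_right 0)"
    using F by (intro tendsto_diff tendsto_sum q) auto
  then have Y: "((\<lambda>t. 2 * B * ?Y t) \<longlongrightarrow> 0) (at_right 0)"
    by (intro tendsto_mult_right_zero) simp
  have X: "(?X \<longlongrightarrow> (\<Sum>m\<in>F. q n m * (f m - f n))) (at_right 0)"
    by (intro tendsto_sum tendsto_mult q tendsto_const)
  have "eventually (\<lambda>t. norm ((?E t - f n) / t - ?X t) \<le> 2 * B * ?Y t) (at_right (0::real))"
    unfolding eventually_at_right_field
  proof (intro exI[of _ 1] conjI allI impI)
    fix t :: real assume t: "0 < t" "t < 1"
    let ?Z = "?E t - f n - (\<Sum>m\<in>F. pmf (P t n) m * (f m - f n))"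
    have "(?E t - f n) / t - ?X t = ?Z / t"
      by (simp add: diff_divide_distrib sum_divide_distrib)
    then have "norm ((?E t - f n) / t - ?X t) = \<bar>?Z\<bar> / t"
      using t by (simp only: real_norm_def abs_divide abs_of_pos)
    also have "\<dots> \<le> 2 * B * (1 - pmf (P t n) n - (\<Sum>m\<in>F. pmf (P t n) m)) / t"
      using t F by (intro divide_right_mono expectation_few_jumps B) auto
    also have "\<dots> = 2 * B * ((1 - pmf (P t n) n - (\<Sum>m\<in>F. pmf (P t n) m)) / t)"
      by (rule times_divide_eq_right[symmetric])
    also have "(1 - pmf (P t n) n - (\<Sum>m\<in>F. pmf (P t n) m)) / t = ?Y t"
      by (simp only: diff_divide_distrib sum_divide_distrib)
    finally show "norm ((?E t - f n) / t - ?X t) \<le> 2 * B * ?Y t" .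
  qed simp
  then have "((\<lambda>t. (?E t - f n) / t - ?X t) \<longlongrightarrow> 0) (at_right 0)"
    using Y by (rule Lim_null_comparison)
  from tendsto_add[OF this X] show ?thesis by simp
qed

text \<open>Stationarity says that the expected increment of \<open>f\<close> over \<open>[0, t]\<close> vanishes for each \<open>t\<close>. Divide
by \<open>t\<close> and let \<open>t\<close> tend to 0 under the expectation; the difference quotients are dominated because the
total rates are at most \<open>Q\<close>.\<close>

lemma stationary_generator_eq_0:
  fixes f :: "'s \<Rightarrow> real"
  assumes P: "jump_semigroup S q P" and p: "stationary_distribution S P p"
    and B: "\<And>m. \<bar>f m\<bar> \<le> B"
    and F: "\<And>n. n \<in> S \<Longrightarrow> finite (F n)" "\<And>n. n \<in> S \<Longrightarrow> F n \<subseteq> S - {n}"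
      "\<And>n m. n \<in> S \<Longrightarrow> m \<in> S - {n} - F n \<Longrightarrow> q n m = 0"
    and Q: "\<And>n. n \<in> S \<Longrightarrow> (\<Sum>m\<in>F n. q n m) \<le> Q"
  shows "measure_pmf.expectation p (\<lambda>n. \<Sum>m\<in>F n. q n m * (f m - f n)) = 0"
proof -
  let ?t = "\<lambda>i::nat. 1 / real (Suc i)"
  let ?D = "\<lambda>t n. (measure_pmf.expectation (P t n) f - f n) / t"
  have t0: "filterlim ?t (at_right 0) sequentially" by real_asymp
  have S: "set_pmf p \<subseteq> S" using p by (simp add: stationary_distribution_def)
  have B0: "0 \<le> B" using B[of undefined] by linarith
  have lim: "(\<lambda>i. measure_pmf.expectation p (?D (?t i)))
    \<longlonglongrightarrow> measure_pmf.expectation p (\<lambda>n. \<Sum>m\<in>F n. q n m * (f m - f n))"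
  proof (rule integral_dominated_convergence[where w="\<lambda>_. 2 * B * Q"])
    show "AE n in measure_pmf p. (\<lambda>i. ?D (?t i) n) \<longlonglongrightarrow> (\<Sum>m\<in>F n. q n m * (f m - f n))"
      unfolding AE_measure_pmf_iff
    proof
      fix n assume "n \<in> set_pmf p"
      with S have n: "n \<in> S" by auto
      show "(\<lambda>i. ?D (?t i) n) \<longlonglongrightarrow> (\<Sum>m\<in>F n. q n m * (f m - f n))"
        by (rule filterlim_compose[OF jump_semigroup_generator[OF P n B F(1)[OF n] F(2)[OF n] F(3)[OF n]] t0])
    qed
    fix i
    show "AE n in measure_pmf p. norm (?D (?t i) n) \<le> 2 * B * Q"
      unfolding AE_measure_pmf_iff
    proof
      fix n assume "n \<in> set_pmf p"
      with S have n: "n \<in> S" by auto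
      have t: "0 < ?t i" by simp
      have "(\<Sum>\<^sub>\<infinity>m\<in>S - {n}. q n m) = (\<Sum>\<^sub>\<infinity>m\<in>F n. q n m)"
        using F n by (intro infsum_cong_neutral) auto
      also have "\<dots> \<le> Q" using F(1)[OF n] Q[OF n] by simp
      finally have "?t i * (\<Sum>\<^sub>\<infinity>m\<in>S - {n}. q n m) \<le> ?t i * Q"
        by (intro mult_left_mono) simp_all
      with jump_semigroup_leave_le[OF P n t] have "1 - pmf (P (?t i) n) n \<le> ?t i * Q"
        by (rule order_trans)
      then have "\<bar>measure_pmf.expectation (P (?t i) n) f - f n\<bar> \<le> 2 * B * (?t i * Q)"
        using expectation_few_jumps[of f B "{}" n "P (?t i) n"] B B0
          mult_left_mono[of "1 - pmf (P (?t i) n) n" "?t i * Q" "2 * B"] by auto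
      then have "\<bar>measure_pmf.expectation (P (?t i) n) f - f n\<bar> / ?t i \<le> 2 * B * Q"
        using t by (simp add: field_simps)
      then show "norm (?D (?t i) n) \<le> 2 * B * Q" by (simp add: abs_mult)
    qed
  qed auto
  have D0: "measure_pmf.expectation p (?D t) = 0" if "0 < t" for t
  proof -
    have "measure_pmf.expectation p (\<lambda>n. measure_pmf.expectation (P t n) f)
        = measure_pmf.expectation p f"
      using expectation_bind_pmf[OF B, of p "P t"] p that by (simp add: stationary_distribution_def)
    moreover have "\<bar>measure_pmf.expectation (P t n) f\<bar> \<le> B" for n
      by (intro order_trans[OF integral_abs_bound] measure_pmf.integral_le_const
          bounded_integrable_pmf[where B=B]) (auto simp: B)
    ultimately show ?thesis
      by (simp add: bounded_integrable_pmf[where B=B] B)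
  qed
  have "measure_pmf.expectation p (?D (?t i)) = 0" for i
    by (rule D0) simp
  with lim have "(\<lambda>i::nat. 0) \<longlonglongrightarrow> measure_pmf.expectation p (\<lambda>n. \<Sum>m\<in>F n. q n m * (f m - f n))"
    by (simp only:)
  then show ?thesis
    by (rule LIMSEQ_unique[OF _ tendsto_const])
qed

section \<open>Sharing a link\<close>

text \<open>Both minima of the model have this form: \<open>\<psi>\<^sub>k = share \<theta>\<^sub>k\<^sub>-\<^sub>1 x\<^sub>k\<close> and, with the roles exchanged,
\<open>\<theta>\<^sub>k = share x\<^sub>k \<theta>\<^sub>k\<^sub>-\<^sub>1\<close>. With a denominator that is at least 1 the case \<open>0 / 0\<close> disappears and
continuity becomes evident.\<close>

definition share :: "real \<Rightarrow> real \<Rightarrow> real" where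
  "share \<theta> x = x / max 1 (\<theta> + x)"

lemma min_share_eq:
  assumes "0 \<le> \<theta>" "0 \<le> x"
  shows "min x (x / (\<theta> + x)) = share \<theta> x"
proof (cases "\<theta> + x \<le> 1")
  case True
  have "x \<le> x / (\<theta> + x)" if "\<theta> + x \<noteq> 0"
    using assms True that mult_left_mono[of "\<theta> + x" 1 x] by (simp add: field_simps)
  moreover have "x = 0" if "\<theta> + x = 0" using assms that by linarith
  ultimately show ?thesis using True by (cases "\<theta> + x = 0") (auto simp: share_def)
next
  case False
  then have "x / (\<theta> + x) \<le> x"
    using assms mult_left_mono[of 1 "\<theta> + x" x] by (simp add: field_simps)
  then show ?thesis using False by (auto simp: share_def)
qed

lemma share_nonneg: "0 \<le> x \<Longrightarrow> 0 \<le> share \<theta> x"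
  by (simp add: share_def)

lemma share_le_1: "0 \<le> \<theta> \<Longrightarrow> 0 \<le> x \<Longrightarrow> share \<theta> x \<le> 1"
  by (simp add: share_def)

lemma psi_eq_share:
  "0 \<le> theta0 \<alpha> x (k - 1) \<Longrightarrow> 0 \<le> x k \<Longrightarrow> psi \<alpha> x k = share (theta0 \<alpha> x (k - 1)) (x k)"
  by (simp add: psi_def min_share_eq)

lemma theta0_step:
  assumes "1 \<le> k" "0 \<le> theta0 \<alpha> x k" "0 \<le> x (Suc k)"
  shows "theta0 \<alpha> x (Suc k) = share (x (Suc k)) (theta0 \<alpha> x k)"
  using assms min_share_eq[of "x (Suc k)" "theta0 \<alpha> x k"] by (cases k) (auto simp: add.commute)

lemma theta0_bounds:
  assumes "0 \<le> \<alpha>" "\<alpha> \<le> 1" "\<And>k. 0 \<le> x k"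
  shows "0 \<le> theta0 \<alpha> x k \<and> theta0 \<alpha> x k \<le> 1"
proof (induction k)
  case (Suc k)
  then show ?case
    using theta0_step[of k \<alpha> x] assms share_nonneg share_le_1[of "x (Suc k)" "theta0 \<alpha> x k"]
    by (cases "k = 0") auto
qed (use assms in auto)

lemma share_lipschitz:
  assumes "0 \<le> \<theta>" "0 \<le> x" "0 \<le> \<theta>'" "0 \<le> x'"
  shows "\<bar>share \<theta> x - share \<theta>' x'\<bar> \<le> \<bar>\<theta> - \<theta>'\<bar> + 2 * \<bar>x - x'\<bar>"
proof -
  define D D' where "D = max 1 (\<theta> + x)" and "D' = max 1 (\<theta>' + x')"
  have D: "1 \<le> D" "1 \<le> D'" "x' \<le> D'" "\<bar>D - D'\<bar> \<le> \<bar>\<theta> - \<theta>'\<bar> + \<bar>x - x'\<bar>"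
    using assms by (auto simp: D_def D'_def max_def abs_if)
  have "share \<theta> x - share \<theta>' x' = ((x - x') + x' / D' * (D' - D)) / D"
    using D by (simp add: share_def D_def[symmetric] D'_def[symmetric] field_simps)
  then have "\<bar>share \<theta> x - share \<theta>' x'\<bar> = \<bar>(x - x') + x' / D' * (D' - D)\<bar> / D"
    using D by (simp only: abs_divide abs_of_pos)
  also have "\<dots> \<le> \<bar>(x - x') + x' / D' * (D' - D)\<bar>"
    using D divide_left_mono[of 1 D "\<bar>(x - x') + x' / D' * (D' - D)\<bar>"] by simp
  also have "\<dots> \<le> \<bar>x - x'\<bar> + \<bar>x' / D' * (D' - D)\<bar>"
    by (rule abs_triangle_ineq)
  finally have "\<bar>share \<theta> x - share \<theta>' x'\<bar> \<le> \<bar>x - x'\<bar> + \<bar>x' / D' * (D' - D)\<bar>" .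
  moreover have "\<bar>x' / D' * (D' - D)\<bar> \<le> 1 * \<bar>D' - D\<bar>"
    unfolding abs_mult using assms D by (intro mult_right_mono) auto
  moreover have "\<bar>D' - D\<bar> \<le> \<bar>\<theta> - \<theta>'\<bar> + \<bar>x - x'\<bar>"
    using D(4) by (simp only: abs_minus_commute)
  ultimately show ?thesis by simp
qed

text \<open>The derivative of \<open>share \<theta> x\<close> in \<open>\<theta>\<close> decays like \<open>1/x\<close>. This is what lets an error in \<open>\<theta>\<close> be
multiplied by the unbounded number \<open>x\<close> at no cost.\<close>

lemma share_lipschitz_weighted:
  assumes "0 \<le> \<theta>" "0 \<le> x" "0 \<le> c"
  shows "x * \<bar>share \<theta> x - share c x\<bar> \<le> \<bar>\<theta> - c\<bar>"
proof -
  define D D' where "D = max 1 (\<theta> + x)" and "D' = max 1 (c + x)"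
  have D: "1 \<le> D" "1 \<le> D'" "x \<le> D" "x \<le> D'" "\<bar>D' - D\<bar> \<le> \<bar>\<theta> - c\<bar>"
    using assms by (auto simp: D_def D'_def max_def abs_if)
  have "x * (share \<theta> x - share c x) = (x / D) * (x / D') * (D' - D)"
    using D by (simp add: share_def D_def[symmetric] D'_def[symmetric] field_simps)
  then have "\<bar>x * (share \<theta> x - share c x)\<bar> = \<bar>(x / D) * (x / D') * (D' - D)\<bar>"
    by (rule arg_cong)
  then have "x * \<bar>share \<theta> x - share c x\<bar> = (x / D) * (x / D') * \<bar>D' - D\<bar>"
    using assms D by (simp only: abs_mult abs_divide abs_of_nonneg abs_of_pos)
  also have "\<dots> \<le> 1 * 1 * \<bar>\<theta> - c\<bar>"
    using D assms by (intro mult_mono) auto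
  finally show ?thesis by simp
qed

text \<open>The difference \<open>share c x - r\<close>, as a fraction with denominator \<open>max 1 (c + x)\<close>, has a numerator
that is the minimum of two increasing affine functions of \<open>x\<close> with zeros \<open>r\<close> and \<open>r * c / (1 - r)\<close>
and with slopes at least \<open>1 - r\<close>. Hence the numerator vanishes at the larger zero \<open>g\<close> and moves away
from 0 with slope at least \<open>1 - r\<close>, on both sides of \<open>g\<close>. As the denominator is at most \<open>1 + x\<close>, the bound is the same for all \<open>c\<close>,
which is the source of uniformity in \<open>\<alpha>\<close>.\<close>

lemma share_coercive:
  assumes r: "0 < r" "r < 1" and c: "0 \<le> c" "c \<le> 1" and x: "0 \<le> x"
    and g: "g = max r (r / (1 - r) * c)"
  shows "(1 - r) * ((x - g)\<^sup>2 / (1 + x)) \<le> (x - g) * (share c x - r)"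
proof -
  define D where "D = max 1 (c + x)"
  have D: "1 \<le> D" "D \<le> 1 + x" using c x by (auto simp: D_def)
  define u where "u = x - r * D"
  have u: "u = min (x - r) ((1 - r) * x - r * c)"
    using mult_left_mono[of 1 "c + x" r] mult_left_mono[of "c + x" 1 r] r
    by (cases "1 \<le> c + x") (auto simp: u_def D_def max_def min_def algebra_simps)
  have s: "share c x - r = u / D"
    using D by (simp add: share_def D_def[symmetric] u_def field_simps)
  have gc: "(1 - r) * g = max ((1 - r) * r) (r * c)"
    using r by (simp add: g max_mult_distrib_left)
  have "(1 - r) * (x - g)\<^sup>2 \<le> (x - g) * u"
  proof (cases "g \<le> x")
    case True
    have "(1 - r) * (x - r) \<le> 1 * (x - r)"
      using True g r by (intro mult_right_mono) auto
    then have "(1 - r) * (x - g) \<le> u"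
      using gc u by (auto simp: algebra_simps)
    then have "(x - g) * ((1 - r) * (x - g)) \<le> (x - g) * u"
      using True by (intro mult_left_mono) auto
    then show ?thesis by (simp add: power2_eq_square algebra_simps)
  next
    case False
    have "u \<le> (1 - r) * (x - g)"
    proof (cases "r \<le> r / (1 - r) * c")
      case True
      then have "(1 - r) * g = r * c" using r g by (simp add: max_def)
      then show ?thesis using u by (simp add: algebra_simps)
    next
      case F2: False
      then have "g = r" using g by simp
      moreover have "r * (x - r) \<le> 0" using False r \<open>g = r\<close> by (simp add: mult_nonneg_nonpos)
      ultimately show ?thesis using u by (simp add: algebra_simps)
    qed
    then have "(x - g) * ((1 - r) * (x - g)) \<le> (x - g) * u"
      using False by (intro mult_left_mono_neg) auto
    then show ?thesis by (simp add: power2_eq_square algebra_simps)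
  qed
  moreover have "(1 - r) * ((x - g)\<^sup>2 / (1 + x)) \<le> (1 - r) * ((x - g)\<^sup>2 / D)"
    using D r by (intro mult_left_mono divide_left_mono) auto
  ultimately have "(1 - r) * ((x - g)\<^sup>2 / (1 + x)) \<le> (x - g) * u / D"
    using D divide_right_mono[of "(1 - r) * (x - g)\<^sup>2" "(x - g) * u" D] by simp
  then show ?thesis by (simp add: s)
qed

section \<open>The limit points\<close>

lemma phi_lim_1: "phi_lim 1 \<rho> \<alpha> = \<alpha>"
  by (simp add: phi_lim_def)

lemma phi_lim_Suc: "1 \<le> k \<Longrightarrow> phi_lim (Suc k) \<rho> \<alpha> = min (phi_lim k \<rho> \<alpha>) (1 - \<rho> (Suc k))"
proof -
  assume "1 \<le> k"
  then have "insert \<alpha> ((\<lambda>k. 1 - \<rho> k) ` {2..Suc k}) = insert (1 - \<rho> (Suc k)) (insert \<alpha> ((\<lambda>k. 1 - \<rho> k) ` {2..k}))"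
    by (auto simp: atLeastAtMostSuc_conv)
  then show ?thesis by (simp add: phi_lim_def min.commute)
qed

lemma phi_lim_bounds:
  assumes "0 \<le> \<alpha>" "\<alpha> \<le> 1" "\<And>j. j \<in> {2..k} \<Longrightarrow> \<rho> j < 1"
  shows "0 \<le> phi_lim k \<rho> \<alpha> \<and> phi_lim k \<rho> \<alpha> \<le> 1"
proof
  show "0 \<le> phi_lim k \<rho> \<alpha>"
    using assms unfolding phi_lim_def by (subst Min_ge_iff) (auto simp: less_imp_le)
  have "phi_lim k \<rho> \<alpha> \<le> \<alpha>"
    unfolding phi_lim_def by (rule Min_le) auto
  then show "phi_lim k \<rho> \<alpha> \<le> 1" using assms by simp
qed

lemma phi_lim_mono: "\<alpha> \<le> u \<Longrightarrow> phi_lim k \<rho> \<alpha> \<le> phi_lim k \<rho> u"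
  unfolding phi_lim_def by (intro Min.boundedI) (auto intro: Min_le order_trans[of _ \<alpha>])

lemma gamma_lim_eq:
  "k \<in> {2..L} \<Longrightarrow> gamma_lim L \<rho> \<alpha> k = max (\<rho> k) (\<rho> k / (1 - \<rho> k) * phi_lim (k - 1) \<rho> \<alpha>)"
proof -
  assume k: "k \<in> {2..L}"
  then have "{2..<k} = {2..k - 1}" by auto
  then show ?thesis using k by (simp add: gamma_lim_def phi_lim_def)
qed

text \<open>Class 0 arriving with rate \<open>c\<close> leaves a link that sits at its balance point with the smaller of \<open>c\<close>
and the capacity that the other class leaves over. This turns the recursion of the \<open>\<theta>\<^sub>k\<close> into the one
of \<open>phi_lim\<close>.\<close>

lemma share_fixed_point:
  assumes r: "0 < r" "r < 1" and c: "0 \<le> c"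
  shows "share (max r (r / (1 - r) * c)) c = min c (1 - r)"
proof -
  define s where "s = 1 - r"
  have s: "0 < s" "s < 1" "r = 1 - s" using r by (auto simp: s_def)
  show ?thesis
  proof (cases "c \<le> s")
    case True
    then have "r * c \<le> r * s" using r by (intro mult_left_mono) auto
    then have "max r (r / s * c) = r" using s by (intro max_absorb1) (simp add: divide_le_eq)
    then show ?thesis using True by (simp add: share_def s_def)
  next
    case False
    then have "r * s \<le> r * c" using r by (intro mult_left_mono) auto
    then have "max r (r / s * c) = r / s * c" using s by (simp add: max_def le_divide_eq)
    moreover have "r / s * c + c = c / s" unfolding s(3) using s(1) by (simp add: field_simps)
    moreover have "max 1 (c / s) = c / s" using False s by (intro max_absorb2) (simp add: le_divide_eq)
    moreover have "c / (c / s) = s" using False s by simp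
    ultimately have "share (max r (r / s * c)) c = s" by (simp only: share_def)
    then show ?thesis using False by (simp only: min_def s_def if_False)
  qed
qed

section \<open>Topology of the orthant\<close>

lemma orthant_nonneg: "x \<in> orthant L \<Longrightarrow> 0 \<le> x k"
  by (cases "k \<in> {2..L}") (auto simp: orthant_def)

lemma compact_orthant_box: "compact {x \<in> orthant L. \<forall>k\<in>{2..L}. x k \<le> R}"
proof -
  let ?I = "\<lambda>k. if k \<in> {2..L} then {0..R} else {0::real}"
  have "compactin (product_topology (\<lambda>_. euclidean) UNIV) (PiE UNIV ?I)"
    by (subst compactin_PiE) auto
  moreover have "PiE UNIV ?I = {x \<in> orthant L. \<forall>k\<in>{2..L}. x k \<le> R}"
    by (auto simp: orthant_def PiE_iff split: if_splits)
  ultimately show ?thesis by (simp add: euclidean_product_topology)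
qed

text \<open>A basic neighbourhood in the product topology may restrict any coordinates; those off \<open>{2..L}\<close> are 0
throughout the orthant, and the others are finitely many, so that a common radius exists.\<close>

lemma orthant_neighbourhood:
  assumes U: "open U" "x \<in> U" and x: "x \<in> orthant L"
  obtains \<delta> where "0 < \<delta>"
    and "\<And>y. y \<in> orthant L \<Longrightarrow> (\<And>k. k \<in> {2..L} \<Longrightarrow> \<bar>y k - x k\<bar> < \<delta>) \<Longrightarrow> y \<in> U"
proof -
  have "openin (product_topology (\<lambda>_. euclidean) UNIV) U"
    using U by (simp add: euclidean_product_topology)
  from product_topology_open_contains_basis[OF this U(2)]
  obtain X where X: "x \<in> (\<Pi>\<^sub>E i\<in>UNIV. X i)" "\<And>i. open (X i)" "(\<Pi>\<^sub>E i\<in>UNIV. X i) \<subseteq> U"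
    by auto
  have "\<exists>d>0. \<forall>r. \<bar>r - x k\<bar> < d \<longrightarrow> r \<in> X k" for k
  proof -
    have "x k \<in> X k" using X(1) by auto
    with X(2)[of k] show ?thesis by (auto simp: open_dist dist_real_def)
  qed
  then obtain d where d: "\<And>k. 0 < d k" "\<And>k r. \<bar>r - x k\<bar> < d k \<Longrightarrow> r \<in> X k"
    by metis
  \<comment> \<open>Inserting 1 keeps the minimum defined if \<open>{2..L}\<close> is empty.\<close>
  define \<delta> where "\<delta> = Min (insert 1 (d ` {2..L}))"
  have "0 < \<delta>" unfolding \<delta>_def using d(1) by (subst Min_gr_iff) auto
  moreover have "y \<in> U" if y: "y \<in> orthant L" and close: "\<And>k. k \<in> {2..L} \<Longrightarrow> \<bar>y k - x k\<bar> < \<delta>" for y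
  proof -
    have "y k \<in> X k" for k
    proof (cases "k \<in> {2..L}")
      case True
      then have "\<delta> \<le> d k" unfolding \<delta>_def by (intro Min_le) auto
      with close[OF True] show ?thesis by (intro d(2)) simp
    next
      case False
      then have "y k = x k" using x y by (auto simp: orthant_def)
      then show ?thesis using X(1) by auto
    qed
    then show ?thesis using X(3) by auto
  qed
  ultimately show ?thesis using that by blast
qed

lemma continuous_on_theta0:
  assumes \<alpha>: "\<alpha> \<in> {0..1}"
  shows "continuous_on (orthant L) (\<lambda>x. theta0 \<alpha> x k)"
proof (induction k)
  case (Suc k)
  show ?case
  proof (cases "k = 0")
    case False
    have "continuous_on (orthant L) (\<lambda>x. theta0 \<alpha> x k / max 1 (x (Suc k) + theta0 \<alpha> x k))"
      by (intro continuous_intros Suc continuous_on_product_coordinates[THEN continuous_on_subset]) auto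
    moreover have "theta0 \<alpha> x (Suc k) = theta0 \<alpha> x k / max 1 (x (Suc k) + theta0 \<alpha> x k)"
      if "x \<in> orthant L" for x
      using False \<alpha> theta0_bounds[of \<alpha> x k] orthant_nonneg[OF that] theta0_step[of k \<alpha> x]
      by (simp add: share_def)
    ultimately show ?thesis by (simp cong: continuous_on_cong)
  qed simp
qed simp

section \<open>Flow balance of one class\<close>

text \<open>Monotone convergence along the truncations \<open>N < M\<close>. It serves to obtain integrability of an unbounded
function from bounds that come from bounded test functions.\<close>

lemma expectation_truncated_limit:
  fixes f :: "'a \<Rightarrow> real" and N :: "'a \<Rightarrow> nat"
  assumes nonneg: "\<And>n. 0 \<le> f n"
    and int: "\<And>M. integrable (measure_pmf p) (\<lambda>n. if N n < M then f n else 0)"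
    and le: "\<And>M. M0 \<le> M \<Longrightarrow> measure_pmf.expectation p (\<lambda>n. if N n < M then f n else 0) \<le> C"
  shows "integrable (measure_pmf p) f" and "measure_pmf.expectation p f \<le> C"
proof -
  let ?I = "\<lambda>M. measure_pmf.expectation p (\<lambda>n. if N n < M then f n else 0)"
  have inc: "incseq ?I"
    unfolding incseq_def by (intro allI impI integral_mono int) (auto simp: nonneg)
  have "?I M \<le> C" for M
    by (rule order_trans[OF incseqD[OF inc max.cobounded1] le[OF max.cobounded2]])
  then have le': "\<forall>M. ?I M \<le> C" ..
  obtain I where I: "?I \<longlonglongrightarrow> I"
    using incseq_convergent[OF inc le'] .
  then have "I \<le> C"
    using le' by (intro LIMSEQ_le_const2) auto
  have "\<forall>\<^sub>F M in sequentially. (if N n < M then f n else 0) = f n" for n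
    by (intro eventually_sequentiallyI[of "Suc (N n)"]) auto
  then have "(\<lambda>M. if N n < M then f n else 0) \<longlonglongrightarrow> f n" for n
    by (rule tendsto_eventually)
  then have lim: "integrable (measure_pmf p) f" "measure_pmf.expectation p f = I"
    by (intro integral_monotone_convergence_nonneg[OF int _ _ _ I]; auto simp: mono_def nonneg)+
  then show "integrable (measure_pmf p) f" "measure_pmf.expectation p f \<le> C"
    using \<open>I \<le> C\<close> by auto
qed

locale quasi_stationary_network =
  fixes L :: nat and lam mu a \<rho> :: "nat \<Rightarrow> real"
    and P :: "real \<Rightarrow> nat \<Rightarrow> real \<Rightarrow> (nat \<Rightarrow> nat) \<Rightarrow> (nat \<Rightarrow> nat) pmf"
    and p :: "real \<Rightarrow> nat \<Rightarrow> (nat \<Rightarrow> nat) pmf"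
  assumes L: "2 \<le> L"
    and lam: "\<And>k. k \<in> {2..L} \<Longrightarrow> 0 < lam k"
    and mu: "\<And>k. k \<in> {2..L} \<Longrightarrow> 0 < mu k"
    and a: "\<And>k. k \<in> {2..L} \<Longrightarrow> 0 < a k"
    and rho: "\<And>k. k \<in> {2..L} \<Longrightarrow> \<rho> k = lam k / mu k"
    and rho_less_1: "\<And>k. k \<in> {2..L} \<Longrightarrow> \<rho> k < 1"
    and semigroup: "\<And>\<alpha> \<beta>. \<alpha> \<in> {0..1} \<Longrightarrow> 1 \<le> \<beta> \<Longrightarrow>
           jump_semigroup (states L) (jump_rate L lam mu a \<alpha> \<beta>) (P \<alpha> \<beta>)"
    and stationary: "\<And>\<alpha> \<beta>. \<alpha> \<in> {0..1} \<Longrightarrow> 1 \<le> \<beta> \<Longrightarrow>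
           stationary_distribution (states L) (P \<alpha> \<beta>) (p \<alpha> \<beta>)"
begin

lemma rho_pos: "k \<in> {2..L} \<Longrightarrow> 0 < \<rho> k"
  using lam mu rho by simp

lemma rescale_nonneg: "0 \<le> rescale L a \<beta> n k"
proof (cases "k \<in> {2..L}")
  case True
  then have "0 \<le> a k" using a[of k] by simp
  then show ?thesis by (simp add: rescale_def)
qed (auto simp: rescale_def)

lemma rescale_eq: "k \<in> {2..L} \<Longrightarrow> rescale L a \<beta> n k = a k / real \<beta> * real (n k)"
  by (simp add: rescale_def)

lemma theta0_rescale_bounds:
  assumes "\<alpha> \<in> {0..1}"
  shows "0 \<le> theta0 \<alpha> (rescale L a \<beta> n) k" "theta0 \<alpha> (rescale L a \<beta> n) k \<le> 1"
  using theta0_bounds[of \<alpha> "rescale L a \<beta> n" k] assms rescale_nonneg by auto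

lemma psi_rescale:
  assumes "\<alpha> \<in> {0..1}"
  shows "psi \<alpha> (rescale L a \<beta> n) k
    = share (theta0 \<alpha> (rescale L a \<beta> n) (k - 1)) (rescale L a \<beta> n k)"
  using assms theta0_rescale_bounds rescale_nonneg by (intro psi_eq_share) auto

lemma psi_rescale_bounds:
  assumes "\<alpha> \<in> {0..1}"
  shows "0 \<le> psi \<alpha> (rescale L a \<beta> n) k" "psi \<alpha> (rescale L a \<beta> n) k \<le> 1"
  using assms theta0_rescale_bounds rescale_nonneg share_nonneg share_le_1
  by (auto simp: psi_rescale)

definition neighbours :: "(nat \<Rightarrow> nat) \<Rightarrow> (nat \<Rightarrow> nat) set" where
  "neighbours n = (\<lambda>k. n(k := n k + 1)) ` {2..L} \<union> (\<lambda>k. n(k := n k - 1)) ` {k \<in> {2..L}. 0 < n k}"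

lemma finite_neighbours: "finite (neighbours n)"
  by (simp add: neighbours_def)

lemma neighbours_subset: "n \<in> states L \<Longrightarrow> neighbours n \<subseteq> states L - {n}"
  by (auto simp: neighbours_def states_def fun_upd_idem_iff)

lemma jump_rate_eq_0: "m \<notin> neighbours n \<Longrightarrow> jump_rate L lam mu a \<alpha> \<beta> n m = 0"
  unfolding jump_rate_def neighbours_def by (intro sum.neutral) auto

text \<open>The generator of the network, in the form in which it acts: a sum over classes instead of a sum over
target states.\<close>

lemma sum_jump_rate:
  "(\<Sum>m\<in>neighbours n. jump_rate L lam mu a \<alpha> \<beta> n m * g m) =
    (\<Sum>k=2..L. real \<beta> * lam k * g (n(k := n k + 1)) +
      (if 0 < n k then real \<beta> * mu k * psi \<alpha> (rescale L a \<beta> n) k * g (n(k := n k - 1)) else 0))"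
    (is "?l = (\<Sum>k=2..L. ?r k)")
proof -
  let ?q = "\<lambda>k m. (if m = n(k := n k + 1) then real \<beta> * lam k else 0) +
        (if 0 < n k \<and> m = n(k := n k - 1)
         then real \<beta> * mu k * psi \<alpha> (rescale L a \<beta> n) k else 0)"
  have "?l = (\<Sum>k=2..L. \<Sum>m\<in>neighbours n. ?q k m * g m)"
    unfolding jump_rate_def sum_distrib_right by (rule sum.swap)
  also have "\<dots> = (\<Sum>k=2..L. ?r k)"
  proof (rule sum.cong)
    fix k assume k: "k \<in> {2..L}"
    have up: "n(k := n k + 1) \<in> neighbours n" and down: "0 < n k \<Longrightarrow> n(k := n k - 1) \<in> neighbours n"
      using k by (auto simp: neighbours_def)
    have "(\<Sum>m\<in>neighbours n. ?q k m * g m)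
        = (\<Sum>m\<in>neighbours n. if m = n(k := n k + 1) then real \<beta> * lam k * g m else 0)
        + (\<Sum>m\<in>neighbours n. if m = n(k := n k - 1) then
             (if 0 < n k then real \<beta> * mu k * psi \<alpha> (rescale L a \<beta> n) k * g m else 0) else 0)"
      unfolding sum.distrib[symmetric] by (intro sum.cong) (auto simp: distrib_right)
    also have "\<dots> = ?r k"
      using up down by (cases "0 < n k") (simp_all add: finite_neighbours)
    finally show "(\<Sum>m\<in>neighbours n. ?q k m * g m) = ?r k" .
  qed simp
  finally show ?thesis .
qed

text \<open>The test function is \<open>n \<mapsto> \<Sum>i<min (n k) M. d i\<close>, whose increments are \<open>d\<close> below level \<open>M\<close> and 0
above. It depends on \<open>n k\<close> only, so the jumps of the other classes drop out although their rates are
coupled. For \<open>d\<close> the indicator of one level this is the balance of the flows up and down across that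
level.\<close>

lemma flow_balance:
  assumes \<alpha>: "\<alpha> \<in> {0..1}" and \<beta>: "1 \<le> \<beta>" and k: "k \<in> {2..L}"
  shows "measure_pmf.expectation (p \<alpha> \<beta>)
    (\<lambda>n. lam k * (if n k < M then d (n k) else 0)
       - mu k * psi \<alpha> (rescale L a \<beta> n) k * (if 0 < n k \<and> n k \<le> M then d (n k - 1) else 0)) = 0"
    (is "measure_pmf.expectation _ ?flow = 0")
proof -
  let ?g = "\<lambda>j::nat. \<Sum>i<min j M. d i :: real"
  let ?q = "jump_rate L lam mu a \<alpha> \<beta>"
  have bound: "\<bar>?g (n k)\<bar> \<le> (\<Sum>i<M. \<bar>d i\<bar>)" for n :: "nat \<Rightarrow> nat"
    by (intro order_trans[OF sum_abs] sum_mono2) auto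
  have total: "(\<Sum>m\<in>neighbours n. ?q n m) \<le> (\<Sum>j=2..L. real \<beta> * lam j + real \<beta> * mu j)" for n
  proof -
    have "(\<Sum>m\<in>neighbours n. ?q n m) = (\<Sum>j=2..L. real \<beta> * lam j +
      (if 0 < n j then real \<beta> * mu j * psi \<alpha> (rescale L a \<beta> n) j else 0))"
      using sum_jump_rate[of \<alpha> \<beta> n "\<lambda>_. 1"] by (simp only: mult_1_right)
    also have "\<dots> \<le> (\<Sum>j=2..L. real \<beta> * lam j + real \<beta> * mu j)"
    proof (rule sum_mono)
      fix j assume "j \<in> {2..L}"
      then have "0 \<le> real \<beta> * mu j" using mu[of j] by simp
      then show "real \<beta> * lam j + (if 0 < n j then real \<beta> * mu j * psi \<alpha> (rescale L a \<beta> n) j else 0)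
          \<le> real \<beta> * lam j + real \<beta> * mu j"
        using mult_left_mono[OF psi_rescale_bounds(2)[OF \<alpha>]] by fastforce
    qed
    finally show ?thesis .
  qed
  have "measure_pmf.expectation (p \<alpha> \<beta>) (\<lambda>n. \<Sum>m\<in>neighbours n. ?q n m * (?g (m k) - ?g (n k))) = 0"
    by (rule stationary_generator_eq_0[OF semigroup[OF \<alpha> \<beta>] stationary[OF \<alpha> \<beta>] bound
        finite_neighbours neighbours_subset _ total]) (simp_all add: jump_rate_eq_0)
  also have "(\<lambda>n. \<Sum>m\<in>neighbours n. ?q n m * (?g (m k) - ?g (n k))) = (\<lambda>n. real \<beta> * ?flow n)"
  proof
    fix n
    have up: "?g (j + 1) - ?g j = (if j < M then d j else 0)" for j
      by (auto simp: min_def le_Suc_eq)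
    have down: "?g (j - 1) - ?g j = - (if j \<le> M then d (j - 1) else 0)" if "0 < j" for j
      using that up[of "j - 1"] by (cases j) (auto simp: Suc_le_eq split: if_splits)
    have "(\<Sum>m\<in>neighbours n. ?q n m * (?g (m k) - ?g (n k))) =
       (\<Sum>j=2..L. if j = k then real \<beta> * ?flow n else 0)"
      unfolding sum_jump_rate[of \<alpha> \<beta> n "\<lambda>m. ?g (m k) - ?g (n k)"]
    proof (intro sum.cong refl)
      fix j
      show "real \<beta> * lam j * (?g ((n(j := n j + 1)) k) - ?g (n k)) +
          (if 0 < n j then real \<beta> * mu j * psi \<alpha> (rescale L a \<beta> n) j *
            (?g ((n(j := n j - 1)) k) - ?g (n k)) else 0)
        = (if j = k then real \<beta> * ?flow n else 0)"
      proof (cases "j = k")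
        case True
        have u: "?g ((n(k := n k + 1)) k) - ?g (n k) = (if n k < M then d (n k) else 0)"
          using up[of "n k"] by (simp only: fun_upd_same)
        have v: "?g ((n(k := n k - 1)) k) - ?g (n k) = - (if n k \<le> M then d (n k - 1) else 0)" if "0 < n k"
          using down[OF that] by (simp only: fun_upd_same)
        show ?thesis
        proof (cases "0 < n k")
          case pos: True
          show ?thesis
            unfolding True u v[OF pos] using pos by (simp add: algebra_simps)
        qed (unfold True u, simp)
      qed simp
    qed
    also have "\<dots> = real \<beta> * ?flow n" using k by simp
    finally show "(\<Sum>m\<in>neighbours n. ?q n m * (?g (m k) - ?g (n k))) = real \<beta> * ?flow n" .
  qed
  finally show ?thesis using \<beta> by simp
qed

text \<open>With \<open>d i = 2 * (h * i - g) + h\<close> in \<open>flow_balance\<close>, which are the increments of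
\<open>(x - g)\<^sup>2 / h\<close> along \<open>x = h * i\<close>, the flow is minus the integrand below. Truncating at \<open>M\<close> leaves a boundary term at level \<open>M\<close>, the last increment \<open>d (M - 1)\<close>
times the rate down; it has the favourable sign as soon as \<open>d (M - 1) \<ge> 0\<close>, which is what the bound on
\<open>M\<close> ensures.\<close>

lemma truncated_drift_le_0:
  assumes \<alpha>: "\<alpha> \<in> {0..1}" and \<beta>: "1 \<le> \<beta>" and k: "k \<in> {2..L}"
    and h: "h = a k / real \<beta>" and M: "g + h \<le> h * real M"
  defines "T \<equiv> \<lambda>n. if n k < M then
      2 * (h * real (n k) - g) * (mu k * psi \<alpha> (rescale L a \<beta> n) k - lam k)
        - h * (lam k + mu k * psi \<alpha> (rescale L a \<beta> n) k) else 0"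
  shows "integrable (measure_pmf (p \<alpha> \<beta>)) T" and "measure_pmf.expectation (p \<alpha> \<beta>) T \<le> 0"
proof -
  define d where "d i = 2 * (h * real i - g) + h" for i
  let ?flow = "\<lambda>n. lam k * (if n k < M then d (n k) else 0)
       - mu k * psi \<alpha> (rescale L a \<beta> n) k * (if 0 < n k \<and> n k \<le> M then d (n k - 1) else 0)"
  \<comment> \<open>Equality holds except at level \<open>M\<close>, where the boundary term is dropped.\<close>
  have *: "T n \<le> - ?flow n" for n
  proof -
    define s where "s = mu k * psi \<alpha> (rescale L a \<beta> n) k"
    have s: "0 \<le> s" using mu[OF k] psi_rescale_bounds(1)[OF \<alpha>, of \<beta> n k] by (simp add: s_def)
    have s0: "s = 0" if "n k = 0"
      using that k by (simp add: s_def psi_def rescale_def)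
    have T: "T n = (if n k < M then 2 * (h * real (n k) - g) * (s - lam k) - h * (lam k + s) else 0)"
      and F: "?flow n = lam k * (if n k < M then d (n k) else 0)
        - s * (if 0 < n k \<and> n k \<le> M then d (n k - 1) else 0)"
      by (simp_all add: s_def T_def)
    have d: "d (n k - 1) = 2 * (h * real (n k) - g) - h" if "0 < n k"
      using that by (simp add: d_def of_nat_diff algebra_simps)
    consider "n k = 0" "n k < M" | "0 < n k" "n k < M" | "0 < n k" "n k = M" | "n k = 0" "n k = M" | "n k > M"
      by linarith
    then show ?thesis
    proof cases
      case 3
      have "0 \<le> h" using a[OF k] h by simp
      with 3 M d have "0 \<le> d (n k - 1)" by simp
      with s have "0 \<le> s * d (n k - 1)" by (rule mult_nonneg_nonneg)
      then show ?thesis unfolding T F using 3 by simp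
    qed (unfold T F, simp_all add: s0 d, simp_all add: d_def algebra_simps)
  qed
  let ?B = "\<Sum>i\<le>M. \<bar>d i\<bar>"
  have dB: "\<bar>d i\<bar> \<le> ?B" if "i \<le> M" for i
    using that member_le_sum[of i "{..M}" "\<lambda>i. \<bar>d i\<bar>"] by auto
  have B0: "0 \<le> ?B" by (intro sum_nonneg) auto
  have psi1: "\<bar>mu k * psi \<alpha> (rescale L a \<beta> n) k\<bar> \<le> mu k" for n
    using mu[OF k] psi_rescale_bounds[OF \<alpha>, of \<beta> n k]
    by (simp add: abs_mult mult_left_le)
  have intF: "integrable (measure_pmf (p \<alpha> \<beta>)) ?flow"
    using mu[OF k] lam[OF k]
    by (intro Bochner_Integration.integrable_diff bounded_integrable_pmf[where B="lam k * ?B"]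
         bounded_integrable_pmf[where B="mu k * ?B"])
      (auto simp: abs_mult[of "lam k"] intro!: mult_left_mono dB B0 order_trans[OF eq_refl[OF abs_mult]] mult_mono psi1)
  have intT: "integrable (measure_pmf (p \<alpha> \<beta>)) T"
  proof (rule bounded_integrable_pmf)
    fix n
    let ?s = "mu k * psi \<alpha> (rescale L a \<beta> n) k"
    have h0: "0 \<le> h" using a[OF k] h by simp
    have "\<bar>h * real (n k) - g\<bar> \<le> h * real M + \<bar>g\<bar>" if "n k < M"
    proof -
      have "h * real (n k) \<le> h * real M" "0 \<le> h * real (n k)"
        using that h0 by (simp_all add: mult_left_mono)
      then show ?thesis by linarith
    qed
    moreover have "\<bar>?s - lam k\<bar> \<le> mu k + lam k" "\<bar>lam k + ?s\<bar> \<le> mu k + lam k"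
      using psi1[of n] lam[OF k] by auto
    ultimately have "\<bar>2 * (h * real (n k) - g) * (?s - lam k)\<bar> \<le> 2 * (h * real M + \<bar>g\<bar>) * (mu k + lam k)"
      "\<bar>h * (lam k + ?s)\<bar> \<le> h * (mu k + lam k)" if "n k < M"
      using that h0 unfolding abs_mult by (auto intro!: mult_mono)
    moreover have "0 \<le> 2 * (h * real M + \<bar>g\<bar>) * (mu k + lam k) + h * (mu k + lam k)"
      using h0 lam[OF k] mu[OF k] by simp
    ultimately show "\<bar>T n\<bar> \<le> 2 * (h * real M + \<bar>g\<bar>) * (mu k + lam k) + h * (mu k + lam k)"
      unfolding T_def by (auto intro: order_trans[OF abs_triangle_ineq4] add_mono)
  qed
  have "measure_pmf.expectation (p \<alpha> \<beta>) T \<le> measure_pmf.expectation (p \<alpha> \<beta>) (\<lambda>n. - ?flow n)"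
    by (rule integral_mono[OF intT Bochner_Integration.integrable_minus[OF intF] *])
  also have "\<dots> = - measure_pmf.expectation (p \<alpha> \<beta>) ?flow"
    by (rule integral_minus)
  also have "\<dots> = 0" using flow_balance[OF \<alpha> \<beta> k, of M d] by simp
  finally show "measure_pmf.expectation (p \<alpha> \<beta>) T \<le> 0" .
  show "integrable (measure_pmf (p \<alpha> \<beta>)) T" by (fact intT)
qed

section \<open>Second moments\<close>

lemma phi_lim_bounds_below_L:
  assumes "\<alpha> \<in> {0..1}" "k \<le> L"
  shows "0 \<le> phi_lim k \<rho> \<alpha>" "phi_lim k \<rho> \<alpha> \<le> 1"
  using phi_lim_bounds[of \<alpha> k \<rho>] assms rho_less_1 by auto

lemma gamma_lim_bounds:
  assumes "\<alpha> \<in> {0..1}" "k \<in> {2..L}"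
  shows "0 \<le> gamma_lim L \<rho> \<alpha> k" "gamma_lim L \<rho> \<alpha> k \<le> 1 / (1 - \<rho> k)"
proof -
  have c: "0 \<le> phi_lim (k - 1) \<rho> \<alpha>" "phi_lim (k - 1) \<rho> \<alpha> \<le> 1"
    using phi_lim_bounds_below_L assms by auto
  have r: "0 < \<rho> k" "\<rho> k < 1" using rho_pos rho_less_1 assms by auto
  show "0 \<le> gamma_lim L \<rho> \<alpha> k" using r assms by (simp add: gamma_lim_eq max_def)
  have "\<rho> k * (1 - \<rho> k) \<le> 1 * 1"
    using r by (intro mult_mono) auto
  then have "\<rho> k \<le> 1 / (1 - \<rho> k)"
    using r by (simp add: le_divide_eq)
  moreover have "\<rho> k * phi_lim (k - 1) \<rho> \<alpha> \<le> 1 * 1"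
    using r c by (intro mult_mono) auto
  then have "\<rho> k / (1 - \<rho> k) * phi_lim (k - 1) \<rho> \<alpha> \<le> 1 / (1 - \<rho> k)"
    using r by (simp add: divide_right_mono)
  ultimately show "gamma_lim L \<rho> \<alpha> k \<le> 1 / (1 - \<rho> k)"
    using assms by (simp add: gamma_lim_eq)
qed

definition theta_err :: "nat \<Rightarrow> nat \<Rightarrow> real \<Rightarrow> real" where
  "theta_err k \<beta> \<alpha> = measure_pmf.expectation (p \<alpha> \<beta>)
     (\<lambda>n. \<bar>theta0 \<alpha> (rescale L a \<beta> n) k - phi_lim k \<rho> \<alpha>\<bar>)"

text \<open>The quantity that the drift controls. It grows like \<open>x\<close> for large \<open>x\<close> and like \<open>(x - \<gamma>\<^sub>k)\<^sup>2\<close> near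
\<open>\<gamma>\<^sub>k\<close>; so a bound on its mean yields tightness, and a mean tending to 0 yields concentration.\<close>

definition weighted_dev :: "nat \<Rightarrow> nat \<Rightarrow> real \<Rightarrow> (nat \<Rightarrow> nat) \<Rightarrow> real" where
  "weighted_dev k \<beta> \<alpha> n = (rescale L a \<beta> n k - gamma_lim L \<rho> \<alpha> k)\<^sup>2 / (1 + rescale L a \<beta> n k)"

lemma weighted_dev_nonneg: "0 \<le> weighted_dev k \<beta> \<alpha> n"
  using rescale_nonneg[of \<beta> n k] by (simp add: weighted_dev_def)

lemma theta_diff_le_1:
  assumes "\<alpha> \<in> {0..1}" "k \<le> L"
  shows "\<bar>theta0 \<alpha> (rescale L a \<beta> n) k - phi_lim k \<rho> \<alpha>\<bar> \<le> 1"
  using theta0_rescale_bounds[OF assms(1), of \<beta> n k] phi_lim_bounds_below_L[OF assms] by linarith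

lemma integrable_theta_diff:
  assumes "\<alpha> \<in> {0..1}" "k \<le> L"
  shows "integrable (measure_pmf (p \<alpha> \<beta>)) (\<lambda>n. \<bar>theta0 \<alpha> (rescale L a \<beta> n) k - phi_lim k \<rho> \<alpha>\<bar>)"
  using theta_diff_le_1[OF assms] by (intro bounded_integrable_pmf[where B=1]) auto

lemma theta_err_bounds:
  assumes "\<alpha> \<in> {0..1}" "k \<le> L"
  shows "0 \<le> theta_err k \<beta> \<alpha>" "theta_err k \<beta> \<alpha> \<le> 1"
  unfolding theta_err_def using integrable_theta_diff[OF assms] theta_diff_le_1[OF assms]
  by (auto intro!: measure_pmf.integral_le_const integral_nonneg_AE)

text \<open>The drift towards \<open>\<gamma>\<^sub>k\<close> at the true \<open>\<theta>\<^sub>k\<^sub>-\<^sub>1\<close> is compared with the one at its limit \<open>c\<^sub>k\<^sub>-\<^sub>1\<close>, for which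
\<open>share_coercive\<close> applies. The error carries the factor \<open>x\<^sub>k - \<gamma>\<^sub>k\<close>: the part with \<open>x\<^sub>k\<close> is handled
by the weighted Lipschitz bound, the part with \<open>\<gamma>\<^sub>k\<close> by the plain one.\<close>

lemma drift_coercive:
  assumes \<alpha>: "\<alpha> \<in> {0..1}" and k: "k \<in> {2..L}"
  defines "x \<equiv> \<lambda>\<beta> n. rescale L a \<beta> n k" and "g \<equiv> gamma_lim L \<rho> \<alpha> k"
  shows "mu k * (1 - \<rho> k) * weighted_dev k \<beta> \<alpha> n \<le>
     (x \<beta> n - g) * (mu k * psi \<alpha> (rescale L a \<beta> n) k - lam k)
     + mu k * (1 + g) * \<bar>theta0 \<alpha> (rescale L a \<beta> n) (k - 1) - phi_lim (k - 1) \<rho> \<alpha>\<bar>"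
proof -
  let ?\<theta> = "theta0 \<alpha> (rescale L a \<beta> n) (k - 1)" and ?c = "phi_lim (k - 1) \<rho> \<alpha>"
  have c: "0 \<le> ?c" "?c \<le> 1" using phi_lim_bounds_below_L \<alpha> k by auto
  have \<theta>: "0 \<le> ?\<theta>" using theta0_rescale_bounds[OF \<alpha>] by simp
  have x: "0 \<le> x \<beta> n" using rescale_nonneg by (simp add: x_def)
  have g: "0 \<le> g" using gamma_lim_bounds[OF \<alpha> k] by (simp add: g_def)
  have r: "0 < \<rho> k" "\<rho> k < 1" using rho_pos rho_less_1 k by auto
  let ?D = "share ?\<theta> (x \<beta> n) - share ?c (x \<beta> n)"
  have "(1 - \<rho> k) * weighted_dev k \<beta> \<alpha> n \<le> (x \<beta> n - g) * (share ?c (x \<beta> n) - \<rho> k)"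
    unfolding weighted_dev_def x_def g_def
    using share_coercive[OF r c, of "rescale L a \<beta> n k" "gamma_lim L \<rho> \<alpha> k"] rescale_nonneg k
    by (simp add: gamma_lim_eq)
  also have "\<dots> = (x \<beta> n - g) * (share ?\<theta> (x \<beta> n) - \<rho> k) - (x \<beta> n - g) * ?D"
    by (simp add: algebra_simps)
  finally have A: "(1 - \<rho> k) * weighted_dev k \<beta> \<alpha> n
      \<le> (x \<beta> n - g) * (share ?\<theta> (x \<beta> n) - \<rho> k) - (x \<beta> n - g) * ?D" .
  have "- ((x \<beta> n - g) * ?D) \<le> (1 + g) * \<bar>?\<theta> - ?c\<bar>"
  proof -
    have "- ((x \<beta> n - g) * ?D) \<le> \<bar>(x \<beta> n - g) * ?D\<bar>" by linarith
    also have "\<dots> = \<bar>x \<beta> n - g\<bar> * \<bar>?D\<bar>" by (rule abs_mult)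
    also have "\<dots> \<le> (x \<beta> n + g) * \<bar>?D\<bar>"
      using x g by (intro mult_right_mono) auto
    also have "\<dots> = x \<beta> n * \<bar>?D\<bar> + g * \<bar>?D\<bar>" by (rule distrib_right)
    also have "\<dots> \<le> \<bar>?\<theta> - ?c\<bar> + g * \<bar>?\<theta> - ?c\<bar>"
      using share_lipschitz_weighted[OF \<theta> x c(1)] share_lipschitz[OF \<theta> x c(1) x] g
      by (intro add_mono mult_left_mono) auto
    finally show ?thesis by (simp add: algebra_simps)
  qed
  with A have "(1 - \<rho> k) * weighted_dev k \<beta> \<alpha> n
      \<le> (x \<beta> n - g) * (share ?\<theta> (x \<beta> n) - \<rho> k) + (1 + g) * \<bar>?\<theta> - ?c\<bar>" by linarith
  from mult_left_mono[OF this, of "mu k"]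
  have "mu k * ((1 - \<rho> k) * weighted_dev k \<beta> \<alpha> n)
     \<le> mu k * ((x \<beta> n - g) * (share ?\<theta> (x \<beta> n) - \<rho> k) + (1 + g) * \<bar>?\<theta> - ?c\<bar>)"
    using mu[OF k] by simp
  moreover have "lam k = mu k * \<rho> k" using rho[OF k] mu[OF k] by simp
  ultimately show ?thesis
    unfolding psi_rescale[OF \<alpha>] by (simp add: x_def algebra_simps)
qed

text \<open>Integrate \<open>drift_coercive\<close> over the states below level \<open>M\<close>, where \<open>truncated_drift_le_0\<close> bounds the
drift term, and let \<open>M\<close> tend to infinity. The right-hand side splits into the noise, of order
\<open>1/\<beta>\<close>, and the error inherited from the links in front.\<close>

lemma weighted_dev_mean_le:
  assumes \<alpha>: "\<alpha> \<in> {0..1}" and \<beta>: "1 \<le> \<beta>" and k: "k \<in> {2..L}"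
  defines "C \<equiv> (a k / real \<beta> + (1 + gamma_lim L \<rho> \<alpha> k) * theta_err (k - 1) \<beta> \<alpha>) / (1 - \<rho> k)"
  shows "integrable (measure_pmf (p \<alpha> \<beta>)) (weighted_dev k \<beta> \<alpha>)"
    and "measure_pmf.expectation (p \<alpha> \<beta>) (weighted_dev k \<beta> \<alpha>) \<le> C"
proof -
  define h where "h = a k / real \<beta>"
  define g where "g = gamma_lim L \<rho> \<alpha> k"
  have h: "0 < h" using a[OF k] \<beta> by (simp add: h_def)
  have g: "0 \<le> g" using gamma_lim_bounds[OF \<alpha> k] by (simp add: g_def)
  have r: "0 < \<rho> k" "\<rho> k < 1" using rho_pos rho_less_1 k by auto
  have x: "rescale L a \<beta> n k = h * real (n k)" for n
    using rescale_eq[OF k] by (simp add: h_def)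
  let ?s = "\<lambda>n. mu k * psi \<alpha> (rescale L a \<beta> n) k"
  let ?T = "\<lambda>M n. if n k < M then
      2 * (h * real (n k) - g) * (?s n - lam k) - h * (lam k + ?s n) else 0"
  let ?t = "\<lambda>n. \<bar>theta0 \<alpha> (rescale L a \<beta> n) (k - 1) - phi_lim (k - 1) \<rho> \<alpha>\<bar>"
  have t: "integrable (measure_pmf (p \<alpha> \<beta>)) ?t"
    using \<alpha> k by (intro integrable_theta_diff) auto
  have s: "0 \<le> ?s n" "?s n \<le> mu k" for n
    using mu[OF k] psi_rescale_bounds[OF \<alpha>, of \<beta> n k] by (auto simp: mult_left_le)
  have lam_le: "lam k \<le> mu k" using rho[OF k] mu[OF k] r by (simp add: divide_less_eq)
  have trunc_bound: "\<bar>if n k < M then f (n k) else 0\<bar> \<le> (\<Sum>i<M. \<bar>f i\<bar>)" for f :: "nat \<Rightarrow> real" and n :: "nat \<Rightarrow> nat" and M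
    using member_le_sum[of "n k" "{..<M}" "\<lambda>i. \<bar>f i\<bar>"] sum_nonneg[of "{..<M}" "\<lambda>i. \<bar>f i\<bar>"] by auto
  have int: "integrable (measure_pmf (p \<alpha> \<beta>)) (\<lambda>n. if n k < M then weighted_dev k \<beta> \<alpha> n else 0)" for M
    unfolding weighted_dev_def x
    by (rule bounded_integrable_pmf[OF trunc_bound])
  obtain M0 where "(g + h) / h \<le> real M0" using real_arch_simple by blast
  then have M0: "g + h \<le> h * real M0" using h by (simp add: divide_le_eq mult.commute)
  have le: "measure_pmf.expectation (p \<alpha> \<beta>) (\<lambda>n. if n k < M then weighted_dev k \<beta> \<alpha> n else 0) \<le> C" if "M0 \<le> M" for M
  proof -
    note M0
    also have "h * real M0 \<le> h * real M"
      using that h by (intro mult_left_mono) auto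
    finally have "g + h \<le> h * real M" .
    note T = truncated_drift_le_0[OF \<alpha> \<beta> k h_def this]
    let ?K = "2 * mu k * (1 - \<rho> k)"
    let ?d = "\<lambda>n. if n k < M then weighted_dev k \<beta> \<alpha> n else 0"
    have K: "0 < ?K" using mu[OF k] r by simp
    have pw: "?K * ?d n - 2 * mu k * h - 2 * mu k * (1 + g) * ?t n \<le> ?T M n" for n
    proof (cases "n k < M")
      case True
      have "h * (lam k + ?s n) \<le> h * (2 * mu k)"
        using h s lam_le by (intro mult_left_mono) (auto intro: order_trans[OF add_mono])
      moreover have "?K * weighted_dev k \<beta> \<alpha> n \<le> 2 * (h * real (n k) - g) * (?s n - lam k) + 2 * mu k * (1 + g) * ?t n"
        using drift_coercive[OF \<alpha> k, of \<beta> n] unfolding x g_def[symmetric] by (simp add: algebra_simps)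
      moreover have "h * (2 * mu k) = 2 * mu k * h" by simp
      ultimately have "?K * weighted_dev k \<beta> \<alpha> n - 2 * mu k * h - 2 * mu k * (1 + g) * ?t n
          \<le> 2 * (h * real (n k) - g) * (?s n - lam k) - h * (lam k + ?s n)"
        by linarith
      then show ?thesis by (simp only: True if_True)
    next
      case False
      moreover have "0 \<le> 2 * mu k * h" "0 \<le> 2 * mu k * (1 + g) * ?t n"
        using mu[OF k] h g by auto
      ultimately show ?thesis by simp
    qed
    have "measure_pmf.expectation (p \<alpha> \<beta>) (\<lambda>n. ?K * ?d n - 2 * mu k * h - 2 * mu k * (1 + g) * ?t n)
       \<le> measure_pmf.expectation (p \<alpha> \<beta>) (?T M)"
      using int t by (intro integral_mono pw T(1)) auto
    also note T(2)
    also have "measure_pmf.expectation (p \<alpha> \<beta>) (\<lambda>n. ?K * ?d n - 2 * mu k * h - 2 * mu k * (1 + g) * ?t n)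
      = ?K * measure_pmf.expectation (p \<alpha> \<beta>) ?d - 2 * mu k * h - 2 * mu k * (1 + g) * theta_err (k - 1) \<beta> \<alpha>"
      using int t by (simp add: theta_err_def)
    finally have "2 * mu k * ((1 - \<rho> k) * measure_pmf.expectation (p \<alpha> \<beta>) ?d)
        \<le> 2 * mu k * (h + (1 + g) * theta_err (k - 1) \<beta> \<alpha>)"
      by (simp add: algebra_simps)
    then have "(1 - \<rho> k) * measure_pmf.expectation (p \<alpha> \<beta>) ?d \<le> h + (1 + g) * theta_err (k - 1) \<beta> \<alpha>"
      using mu[OF k] by (simp only: mult_le_cancel_left_pos)
    then show ?thesis unfolding C_def h_def[symmetric] g_def[symmetric]
      using r by (simp add: le_divide_eq mult.commute)
  qed
  show "integrable (measure_pmf (p \<alpha> \<beta>)) (weighted_dev k \<beta> \<alpha>)"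
    and "measure_pmf.expectation (p \<alpha> \<beta>) (weighted_dev k \<beta> \<alpha>) \<le> C"
    by (rule expectation_truncated_limit[where N="\<lambda>n. n k", OF weighted_dev_nonneg int le]; assumption)+
qed

section \<open>Uniform convergence in mean\<close>

definition pos_err :: "nat \<Rightarrow> nat \<Rightarrow> real \<Rightarrow> real" where
  "pos_err k \<beta> \<alpha> = measure_pmf.expectation (p \<alpha> \<beta>)
     (\<lambda>n. \<bar>rescale L a \<beta> n k - gamma_lim L \<rho> \<alpha> k\<bar>)"

lemma rescale_le_weighted_dev:
  assumes \<alpha>: "\<alpha> \<in> {0..1}" and k: "k \<in> {2..L}"
  shows "rescale L a \<beta> n k \<le> weighted_dev k \<beta> \<alpha> n + 1 + 2 * gamma_lim L \<rho> \<alpha> k"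
proof -
  define x g where "x = rescale L a \<beta> n k" and "g = gamma_lim L \<rho> \<alpha> k"
  have x: "0 \<le> x" using rescale_nonneg by (simp add: x_def)
  have "0 \<le> 1 + 2 * g + g\<^sup>2"
    using gamma_lim_bounds(1)[OF \<alpha> k] by (simp add: g_def)
  then have "(x - 1 - 2 * g) * (1 + x) \<le> (x - g)\<^sup>2"
    by (simp add: power2_eq_square algebra_simps)
  then have "x - 1 - 2 * g \<le> (x - g)\<^sup>2 / (1 + x)"
    using x by (simp add: le_divide_eq)
  then show ?thesis unfolding weighted_dev_def x_def[symmetric] g_def[symmetric] by linarith
qed

lemma mean_bound:
  assumes \<alpha>: "\<alpha> \<in> {0..1}" and \<beta>: "1 \<le> \<beta>" and k: "k \<in> {2..L}"
  shows "integrable (measure_pmf (p \<alpha> \<beta>)) (\<lambda>n. rescale L a \<beta> n k)"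
    and "measure_pmf.expectation (p \<alpha> \<beta>) (\<lambda>n. rescale L a \<beta> n k)
      \<le> measure_pmf.expectation (p \<alpha> \<beta>) (weighted_dev k \<beta> \<alpha>) + 1 + 2 * gamma_lim L \<rho> \<alpha> k"
proof -
  let ?g = "gamma_lim L \<rho> \<alpha> k"
  have int: "integrable (measure_pmf (p \<alpha> \<beta>)) (\<lambda>n. weighted_dev k \<beta> \<alpha> n + 1 + 2 * ?g)"
    using weighted_dev_mean_le(1)[OF assms] by simp
  show i: "integrable (measure_pmf (p \<alpha> \<beta>)) (\<lambda>n. rescale L a \<beta> n k)"
    using order_trans[OF rescale_le_weighted_dev[OF \<alpha> k] abs_ge_self] rescale_nonneg
    by (intro Bochner_Integration.integrable_bound[OF int]) auto
  have "measure_pmf.expectation (p \<alpha> \<beta>) (\<lambda>n. rescale L a \<beta> n k)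
      \<le> measure_pmf.expectation (p \<alpha> \<beta>) (\<lambda>n. weighted_dev k \<beta> \<alpha> n + 1 + 2 * ?g)"
    by (intro integral_mono i int rescale_le_weighted_dev[OF \<alpha> k])
  also have "\<dots> = measure_pmf.expectation (p \<alpha> \<beta>) (weighted_dev k \<beta> \<alpha>) + 1 + 2 * ?g"
    using weighted_dev_mean_le(1)[OF assms] by simp
  finally show "measure_pmf.expectation (p \<alpha> \<beta>) (\<lambda>n. rescale L a \<beta> n k)
      \<le> measure_pmf.expectation (p \<alpha> \<beta>) (weighted_dev k \<beta> \<alpha>) + 1 + 2 * ?g" .
qed

lemma integrable_pos_err:
  assumes "\<alpha> \<in> {0..1}" "1 \<le> \<beta>" "k \<in> {2..L}"
  shows "integrable (measure_pmf (p \<alpha> \<beta>)) (\<lambda>n. \<bar>rescale L a \<beta> n k - gamma_lim L \<rho> \<alpha> k\<bar>)"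
  using mean_bound(1)[OF assms] by (intro integrable_abs Bochner_Integration.integrable_diff) auto

lemma pos_err_nonneg: "0 \<le> pos_err k \<beta> \<alpha>"
  unfolding pos_err_def by (intro integral_nonneg_AE) simp

text \<open>The elementary inequality \<open>y \<le> s * w + y\<^sup>2 / (4 * s * w)\<close> with \<open>w = 1 + x\<^sub>k\<close> and
\<open>y = \<bar>x\<^sub>k - \<gamma>\<^sub>k\<bar>\<close>, integrated. The free parameter \<open>s\<close> plays the part of an optimisation, as in the
proof of the Cauchy-Schwarz inequality.\<close>

lemma pos_err_le:
  assumes \<alpha>: "\<alpha> \<in> {0..1}" and \<beta>: "1 \<le> \<beta>" and k: "k \<in> {2..L}" and s: "0 < s"
    and V: "V = measure_pmf.expectation (p \<alpha> \<beta>) (weighted_dev k \<beta> \<alpha>)"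
  shows "pos_err k \<beta> \<alpha> \<le> s * (V + 2 + 2 * gamma_lim L \<rho> \<alpha> k) + V / (4 * s)"
proof -
  let ?x = "\<lambda>n. rescale L a \<beta> n k" and ?g = "gamma_lim L \<rho> \<alpha> k"
  have pw: "\<bar>?x n - ?g\<bar> \<le> s * (1 + ?x n) + weighted_dev k \<beta> \<alpha> n / (4 * s)" for n
  proof -
    define y w where "y = \<bar>?x n - ?g\<bar>" and "w = 1 + ?x n"
    have w: "0 < w" using rescale_nonneg[of \<beta> n k] by (simp add: w_def)
    have "0 \<le> (2 * s * w - y)\<^sup>2" by simp
    then have "y * (4 * s * w) \<le> (s * w) * (4 * s * w) + y\<^sup>2"
      by (simp add: power2_eq_square algebra_simps)
    then have "y \<le> ((s * w) * (4 * s * w) + y\<^sup>2) / (4 * s * w)"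
      using s w by (simp add: le_divide_eq)
    also have "\<dots> = s * w + (y\<^sup>2 / w) / (4 * s)"
      using s w by (simp add: add_divide_distrib mult.commute)
    finally show ?thesis by (simp add: y_def w_def weighted_dev_def)
  qed
  note int = mean_bound(1)[OF \<alpha> \<beta> k] weighted_dev_mean_le(1)[OF \<alpha> \<beta> k]
  have "pos_err k \<beta> \<alpha> \<le> measure_pmf.expectation (p \<alpha> \<beta>) (\<lambda>n. s * (1 + ?x n) + weighted_dev k \<beta> \<alpha> n / (4 * s))"
    unfolding pos_err_def using int
    by (intro integral_mono integrable_pos_err[OF \<alpha> \<beta> k] pw) auto
  also have "\<dots> = s * (1 + measure_pmf.expectation (p \<alpha> \<beta>) ?x) + V / (4 * s)"
    using int s by (simp add: V)
  also have "\<dots> \<le> s * (V + 2 + 2 * ?g) + V / (4 * s)"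
    using mean_bound(2)[OF \<alpha> \<beta> k] s by (intro add_right_mono mult_left_mono) (auto simp: V)
  finally show ?thesis .
qed

lemma theta_err_Suc_le:
  assumes \<alpha>: "\<alpha> \<in> {0..1}" and \<beta>: "1 \<le> \<beta>" and k: "1 \<le> k" "Suc k \<le> L"
  shows "theta_err (Suc k) \<beta> \<alpha> \<le> pos_err (Suc k) \<beta> \<alpha> + 2 * theta_err k \<beta> \<alpha>"
proof -
  have k': "Suc k \<in> {2..L}" using k by auto
  let ?\<theta> = "\<lambda>n. theta0 \<alpha> (rescale L a \<beta> n) k" and ?x = "\<lambda>n. rescale L a \<beta> n (Suc k)"
  let ?c = "phi_lim k \<rho> \<alpha>" and ?g = "gamma_lim L \<rho> \<alpha> (Suc k)"
  have \<theta>: "0 \<le> ?\<theta> n" for n using theta0_rescale_bounds[OF \<alpha>] by simp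
  have c: "0 \<le> ?c" using phi_lim_bounds_below_L \<alpha> k by simp
  have "phi_lim (Suc k) \<rho> \<alpha> = share ?g ?c"
    using share_fixed_point[OF rho_pos[OF k'] rho_less_1[OF k'] c]
    by (simp add: gamma_lim_eq[OF k'] phi_lim_Suc[OF k(1)])
  moreover have "theta0 \<alpha> (rescale L a \<beta> n) (Suc k) = share (?x n) (?\<theta> n)" for n
    using k \<theta> rescale_nonneg by (intro theta0_step) auto
  ultimately have pw: "\<bar>theta0 \<alpha> (rescale L a \<beta> n) (Suc k) - phi_lim (Suc k) \<rho> \<alpha>\<bar>
      \<le> \<bar>?x n - ?g\<bar> + 2 * \<bar>?\<theta> n - ?c\<bar>" for n
    using share_lipschitz[OF rescale_nonneg \<theta> gamma_lim_bounds(1)[OF \<alpha> k'] c] by simp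
  have "theta_err (Suc k) \<beta> \<alpha>
      \<le> measure_pmf.expectation (p \<alpha> \<beta>) (\<lambda>n. \<bar>?x n - ?g\<bar> + 2 * \<bar>?\<theta> n - ?c\<bar>)"
    unfolding theta_err_def using k integrable_theta_diff[OF \<alpha>, of k] integrable_pos_err[OF \<alpha> \<beta> k']
    by (intro integral_mono integrable_theta_diff[OF \<alpha>] pw) auto
  also have "\<dots> = pos_err (Suc k) \<beta> \<alpha> + 2 * theta_err k \<beta> \<alpha>"
    unfolding theta_err_def pos_err_def
    using k integrable_theta_diff[OF \<alpha>, of k] integrable_pos_err[OF \<alpha> \<beta> k'] by simp
  finally show ?thesis .
qed

text \<open>\<open>\<gamma>\<^sub>k\<close> is at most \<open>1 / (1 - \<rho>\<^sub>k)\<close> whatever \<open>\<alpha>\<close> is, so the bound \<open>weighted_dev_mean_le\<close> tends to 0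
uniformly in \<open>\<alpha>\<close>; then \<open>pos_err_le\<close> with a small fixed \<open>s\<close> applies.\<close>

lemma uniform_limit_pos_err:
  assumes k: "k \<in> {2..L}"
    and lim: "uniform_limit {0..1} (theta_err (k - 1)) (\<lambda>_. 0) sequentially"
  shows "uniform_limit {0..1} (pos_err k) (\<lambda>_. 0) sequentially"
proof (rule uniform_limitI)
  fix e :: real assume e: "0 < e"
  define G where "G = 1 / (1 - \<rho> k)"
  define s where "s = e / 4 / (3 + 2 * G)"
  \<comment> \<open>If \<open>V \<le> t\<close>, the two terms of \<open>pos_err_le\<close> are at most \<open>e / 4\<close> and \<open>e / 2\<close>.\<close>
  define t where "t = min 1 (2 * s * e)"
  have r: "0 < 1 - \<rho> k" using rho_less_1[OF k] by simp
  then have G: "0 < G" by (simp add: G_def)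
  have s: "0 < s" using e G by (simp add: s_def)
  have t: "0 < t" using e s by (simp add: t_def)
  have "(\<lambda>\<beta>. a k / real \<beta>) \<longlonglongrightarrow> 0"
    by (rule lim_const_over_n)
  moreover have "0 < (1 - \<rho> k) * t / 2" using r t by simp
  ultimately have "\<forall>\<^sub>F \<beta> in sequentially. a k / real \<beta> < (1 - \<rho> k) * t / 2"
    by (rule order_tendstoD)
  moreover have "\<forall>\<^sub>F \<beta> in sequentially. \<forall>\<alpha>\<in>{0..1}. dist (theta_err (k - 1) \<beta> \<alpha>) 0 < (1 - \<rho> k) * t / (2 * (1 + G))"
    using lim r t G by (intro uniform_limitD) auto
  ultimately show "\<forall>\<^sub>F \<beta> in sequentially. \<forall>\<alpha>\<in>{0..1}. dist (pos_err k \<beta> \<alpha>) 0 < e"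
    using eventually_ge_at_top[of 1]
  proof eventually_elim
    case (elim \<beta>)
    show ?case
    proof
      fix \<alpha> :: real assume \<alpha>: "\<alpha> \<in> {0..1}"
      define V where "V = measure_pmf.expectation (p \<alpha> \<beta>) (weighted_dev k \<beta> \<alpha>)"
      let ?D = "theta_err (k - 1) \<beta> \<alpha>" and ?g = "gamma_lim L \<rho> \<alpha> k"
      have g: "0 \<le> ?g" "?g \<le> G" using gamma_lim_bounds[OF \<alpha> k] by (auto simp: G_def)
      have D: "0 \<le> ?D" using theta_err_bounds[OF \<alpha>, of "k - 1"] k by auto
      moreover have "dist ?D 0 < (1 - \<rho> k) * t / (2 * (1 + G))" using elim(2) \<alpha> by blast
      ultimately have D': "?D < (1 - \<rho> k) * t / (2 * (1 + G))" by simp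
      have "(1 + ?g) * ?D \<le> (1 + G) * ?D"
        using g D by (intro mult_right_mono) auto
      also have "\<dots> \<le> (1 - \<rho> k) * t / 2"
        using D' G by (simp add: field_simps)
      finally have "a k / real \<beta> + (1 + ?g) * ?D \<le> (1 - \<rho> k) * t"
        using elim(1) by linarith
      then have "(a k / real \<beta> + (1 + ?g) * ?D) / (1 - \<rho> k) \<le> t"
        using r by (simp add: divide_le_eq mult.commute)
      with weighted_dev_mean_le(2)[OF \<alpha> elim(3) k] have Vt: "V \<le> t" by (simp add: V_def)
      have "pos_err k \<beta> \<alpha> \<le> s * (V + 2 + 2 * ?g) + V / (4 * s)"
        by (rule pos_err_le[OF \<alpha> elim(3) k s V_def])
      also have "\<dots> \<le> s * (3 + 2 * G) + (2 * s * e) / (4 * s)"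
        using s g Vt by (intro add_mono mult_left_mono divide_right_mono) (auto simp: t_def)
      also have "\<dots> = e / 4 + e / 2"
      proof -
        have cancel: "x / y * y = x" if "0 < y" for x y :: real using that by simp
        have "s * (3 + 2 * G) = e / 4" unfolding s_def by (rule cancel) (use G in linarith)
        moreover have "(2 * s * e) / (4 * s) = e / 2" using s by simp
        ultimately show ?thesis by (simp only:)
      qed
      finally show "dist (pos_err k \<beta> \<alpha>) 0 < e"
        using e pos_err_nonneg[of k \<beta> \<alpha>] by simp
    qed
  qed
qed

lemma uniform_limit_theta_err:
  assumes "1 \<le> k" "k \<le> L"
  shows "uniform_limit {0..1} (theta_err k) (\<lambda>_. 0) sequentially"
  using assms
proof (induction k rule: dec_induct)
  case base
  have "theta_err 1 = (\<lambda>\<beta> \<alpha>. 0)"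
    unfolding theta_err_def phi_lim_1 by simp
  then show ?case by (simp add: uniform_limit_const)
next
  case (step k)
  then have IH: "uniform_limit {0..1} (theta_err k) (\<lambda>_. 0) sequentially" by simp
  then have "uniform_limit {0..1} (pos_err (Suc k)) (\<lambda>_. 0) sequentially"
    using step by (intro uniform_limit_pos_err) auto
  from uniform_limit_add[OF this uniform_limit_add[OF IH IH]]
  have lim: "uniform_limit {0..1} (\<lambda>\<beta> \<alpha>. pos_err (Suc k) \<beta> \<alpha> + 2 * theta_err k \<beta> \<alpha>) (\<lambda>_. 0) sequentially"
    by (simp only: add_0_left mult_2)
  have "\<forall>\<^sub>F \<beta> in sequentially. \<forall>\<alpha>\<in>{0..1}. norm (theta_err (Suc k) \<beta> \<alpha>)
      \<le> pos_err (Suc k) \<beta> \<alpha> + 2 * theta_err k \<beta> \<alpha>"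
    using eventually_ge_at_top[of 1]
  proof eventually_elim
    case (elim \<beta>)
    then show ?case
      using theta_err_Suc_le[OF _ elim, of _ k] theta_err_bounds(1)[of _ "Suc k"] step by auto
  qed
  then show ?case using lim by (rule uniform_limit_null_comparison)
qed

section \<open>Tightness, concentration and the mean rate of class 0\<close>

lemma rescale_in_orthant: "rescale L a \<beta> n \<in> orthant L"
  using rescale_nonneg[of \<beta> n] by (auto simp: orthant_def) (auto simp: rescale_def)

lemma measurable_rescale:
  "rescale L a \<beta> \<in> measurable (measure_pmf q) (restrict_space borel (orthant L))"
  by (auto simp: measurable_def space_restrict_space rescale_in_orthant)

lemma integral_rescaled_law:
  fixes f :: "(nat \<Rightarrow> real) \<Rightarrow> real"
  assumes "continuous_on (orthant L) f"
  shows "integral\<^sup>L (rescaled_law L a \<beta> q) f = measure_pmf.expectation q (\<lambda>n. f (rescale L a \<beta> n))"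
  unfolding rescaled_law_def
  by (intro integral_distr measurable_rescale borel_measurable_continuous_on_restrict assms)

text \<open>The bound on \<open>E x\<^sub>k\<close> that results from \<open>\<beta> \<ge> 1\<close>, \<open>\<bar>\<theta>\<^sub>k\<^sub>-\<^sub>1 - c\<^sub>k\<^sub>-\<^sub>1\<bar> \<le> 1\<close> and
\<open>\<gamma>\<^sub>k \<le> 1 / (1 - \<rho>\<^sub>k)\<close>.\<close>

definition mean_cap :: "nat \<Rightarrow> real" where
  "mean_cap k = (a k + (1 + 1 / (1 - \<rho> k))) / (1 - \<rho> k) + 1 + 2 * (1 / (1 - \<rho> k))"

lemma mean_le_mean_cap:
  assumes \<alpha>: "\<alpha> \<in> {0..1}" and \<beta>: "1 \<le> \<beta>" and k: "k \<in> {2..L}"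
  shows "measure_pmf.expectation (p \<alpha> \<beta>) (\<lambda>n. rescale L a \<beta> n k) \<le> mean_cap k"
proof -
  let ?G = "1 / (1 - \<rho> k)"
  let ?g = "gamma_lim L \<rho> \<alpha> k" and ?D = "theta_err (k - 1) \<beta> \<alpha>"
  have r: "0 < 1 - \<rho> k" using rho_less_1[OF k] by simp
  have g: "0 \<le> ?g" "?g \<le> ?G" using gamma_lim_bounds[OF \<alpha> k] by auto
  have D: "0 \<le> ?D" "?D \<le> 1" using theta_err_bounds[OF \<alpha>, of "k - 1"] k by auto
  have "a k / real \<beta> \<le> a k"
    using \<beta> a[OF k] by (simp add: divide_le_eq)
  moreover have "(1 + ?g) * ?D \<le> (1 + ?G) * 1"
    using g D r by (intro mult_mono) auto
  ultimately have "(a k / real \<beta> + (1 + ?g) * ?D) / (1 - \<rho> k) \<le> (a k + (1 + ?G)) / (1 - \<rho> k)"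
    using r by (intro divide_right_mono) auto
  then show ?thesis unfolding mean_cap_def
    using mean_bound(2)[OF \<alpha> \<beta> k] weighted_dev_mean_le(2)[OF \<alpha> \<beta> k] g by linarith
qed

theorem tight_rescaled_laws:
  "tight_on (orthant L) {rescaled_law L a \<beta> (p \<alpha> \<beta>) |\<alpha> \<beta>. \<alpha> \<in> {0..1} \<and> 1 \<le> \<beta>}"
  unfolding tight_on_def
proof (intro allI impI)
  fix \<epsilon> :: real assume \<epsilon>: "0 < \<epsilon>"
  define R where "R = max 1 ((\<Sum>k=2..L. mean_cap k) / \<epsilon>)"
  have R: "0 < R" "(\<Sum>k=2..L. mean_cap k) \<le> \<epsilon> * R"
    using \<epsilon> by (auto simp: R_def max_def field_simps)
  let ?K = "{x \<in> orthant L. \<forall>k\<in>{2..L}. x k \<le> R}"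
  have "measure (rescaled_law L a \<beta> (p \<alpha> \<beta>)) (orthant L - ?K) \<le> \<epsilon>" if \<alpha>: "\<alpha> \<in> {0..1}" and \<beta>: "1 \<le> \<beta>" for \<alpha> \<beta>
  proof -
    let ?A = "{n. rescale L a \<beta> n \<notin> ?K}" and ?x = "rescale L a \<beta>"
    have "closed ?K" by (intro compact_imp_closed compact_orthant_box)
    then have "- ?K \<in> sets borel" by (intro borel_open open_Compl)
    then have "orthant L \<inter> - ?K \<in> sets (restrict_space borel (orthant L))"
      unfolding sets_restrict_space by (rule imageI)
    then have "orthant L - ?K \<in> sets (restrict_space borel (orthant L))"
      by (simp only: Diff_eq)
    then have "measure (rescaled_law L a \<beta> (p \<alpha> \<beta>)) (orthant L - ?K)
        = measure_pmf.prob (p \<alpha> \<beta>) (?x -` (orthant L - ?K) \<inter> space (measure_pmf (p \<alpha> \<beta>)))"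
      unfolding rescaled_law_def by (intro measure_distr measurable_rescale)
    also have "?x -` (orthant L - ?K) \<inter> space (measure_pmf (p \<alpha> \<beta>)) = ?A"
      using rescale_in_orthant by auto
    also have "measure_pmf.prob (p \<alpha> \<beta>) ?A = measure_pmf.expectation (p \<alpha> \<beta>) (indicator ?A)"
      by simp
    also have "\<dots> \<le> measure_pmf.expectation (p \<alpha> \<beta>) (\<lambda>n. (\<Sum>k=2..L. ?x n k) / R)"
    proof (rule integral_mono)
      show "integrable (measure_pmf (p \<alpha> \<beta>)) (indicator ?A :: _ \<Rightarrow> real)"
        by (intro bounded_integrable_pmf[where B=1]) (auto simp: indicator_def)
      show "integrable (measure_pmf (p \<alpha> \<beta>)) (\<lambda>n. (\<Sum>k=2..L. ?x n k) / R)"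
        by (intro Bochner_Integration.integrable_divide Bochner_Integration.integrable_sum mean_bound(1)[OF \<alpha> \<beta>])
      fix n
      show "indicator ?A n \<le> (\<Sum>k=2..L. ?x n k) / R"
      proof (cases "n \<in> ?A")
        case True
        then obtain k where k: "k \<in> {2..L}" "R < ?x n k"
          using rescale_in_orthant by force
        then have "R \<le> (\<Sum>k=2..L. ?x n k)"
          using member_le_sum[of k "{2..L}" "?x n"] rescale_nonneg by fastforce
        then show ?thesis using True R by simp
      qed (use R in \<open>auto intro!: divide_nonneg_pos sum_nonneg rescale_nonneg\<close>)
    qed
    also have "\<dots> = measure_pmf.expectation (p \<alpha> \<beta>) (\<lambda>n. \<Sum>k=2..L. ?x n k) / R"
      by (rule integral_divide_zero)
    also have "measure_pmf.expectation (p \<alpha> \<beta>) (\<lambda>n. \<Sum>k=2..L. ?x n k)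
        = (\<Sum>k=2..L. measure_pmf.expectation (p \<alpha> \<beta>) (\<lambda>n. ?x n k))"
      by (rule Bochner_Integration.integral_sum) (rule mean_bound(1)[OF \<alpha> \<beta>])
    also have "(\<Sum>k=2..L. measure_pmf.expectation (p \<alpha> \<beta>) (\<lambda>n. ?x n k)) / R
        \<le> (\<Sum>k=2..L. mean_cap k) / R"
      using mean_le_mean_cap[OF \<alpha> \<beta>] R by (intro divide_right_mono sum_mono) auto
    also have "\<dots> \<le> \<epsilon>" using R by (simp add: divide_le_eq)
    finally show ?thesis .
  qed
  then show "\<exists>K\<subseteq>orthant L. compact K \<and>
      (\<forall>M\<in>{rescaled_law L a \<beta> (p \<alpha> \<beta>) |\<alpha> \<beta>. \<alpha> \<in> {0..1} \<and> 1 \<le> \<beta>}. measure M (orthant L - K) \<le> \<epsilon>)"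
    by (intro exI[of _ ?K]) (auto simp: compact_orthant_box)
qed

lemma gamma_lim_in_orthant: "\<alpha> \<in> {0..1} \<Longrightarrow> gamma_lim L \<rho> \<alpha> \<in> orthant L"
  using gamma_lim_bounds(1) by (auto simp: orthant_def) (auto simp: gamma_lim_def)

lemma pos_err_tendsto:
  assumes "\<alpha> \<in> {0..1}" "k \<in> {2..L}"
  shows "(\<lambda>\<beta>. pos_err k \<beta> \<alpha>) \<longlonglongrightarrow> 0"
proof -
  have "uniform_limit {0..1} (pos_err k) (\<lambda>_. 0) sequentially"
    using assms(2) by (intro uniform_limit_pos_err uniform_limit_theta_err) auto
  from tendsto_uniform_limitI[OF this assms(1)] show ?thesis .
qed

text \<open>Near \<open>\<gamma>\<close> the integrand is close to its value there, and far from \<open>\<gamma>\<close> some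
\<open>\<bar>x\<^sub>k - \<gamma>\<^sub>k\<bar>\<close> is at least \<open>\<delta>\<close>; there the bound \<open>2 * B\<close> is at most \<open>2 * B / \<delta>\<close> times the sum
of these distances, whose mean tends to 0.\<close>

theorem rescaled_law_tendsto_dirac:
  assumes \<alpha>: "\<alpha> \<in> {0..1}"
  shows "weak_conv_on (orthant L) (\<lambda>\<beta>. rescaled_law L a \<beta> (p \<alpha> \<beta>))
    (return (restrict_space borel (orthant L)) (gamma_lim L \<rho> \<alpha>))"
  unfolding weak_conv_on_def
proof (intro allI impI, elim conjE)
  fix f :: "(nat \<Rightarrow> real) \<Rightarrow> real"
  assume f: "continuous_on (orthant L) f" and "bounded (f ` orthant L)"
  then obtain B where B: "\<And>x. x \<in> orthant L \<Longrightarrow> \<bar>f x\<bar> \<le> B"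
    by (auto simp: bounded_iff)
  let ?g = "gamma_lim L \<rho> \<alpha>" and ?x = "\<lambda>\<beta>. rescale L a \<beta>"
  have g: "?g \<in> orthant L" by (rule gamma_lim_in_orthant[OF \<alpha>])
  have B0: "0 \<le> B" using B[OF g] by linarith
  have "(\<lambda>\<beta>. measure_pmf.expectation (p \<alpha> \<beta>) (\<lambda>n. f (?x \<beta> n))) \<longlonglongrightarrow> f ?g"
  proof (rule tendstoI)
    fix e :: real assume e: "0 < e"
    obtain U where U: "open U" "?g \<in> U" "\<And>y. y \<in> U \<Longrightarrow> y \<in> orthant L \<Longrightarrow> dist (f y) (f ?g) < e / 2"
      using f g e unfolding continuous_on_topological
      by (metis dist_commute half_gt_zero mem_ball open_ball centre_in_ball)
    obtain \<delta> where \<delta>: "0 < \<delta>"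
      "\<And>y. y \<in> orthant L \<Longrightarrow> (\<And>k. k \<in> {2..L} \<Longrightarrow> \<bar>y k - ?g k\<bar> < \<delta>) \<Longrightarrow> y \<in> U"
      using orthant_neighbourhood[OF U(1,2) g] by blast
    let ?S = "\<lambda>\<beta> n. \<Sum>k=2..L. \<bar>?x \<beta> n k - ?g k\<bar>"
    have pw: "\<bar>f (?x \<beta> n) - f ?g\<bar> \<le> e / 2 + 2 * B / \<delta> * ?S \<beta> n" for \<beta> n
    proof (cases "\<forall>k\<in>{2..L}. \<bar>?x \<beta> n k - ?g k\<bar> < \<delta>")
      case True
      then have "?x \<beta> n \<in> U" using \<delta>(2)[OF rescale_in_orthant] by blast
      then have "\<bar>f (?x \<beta> n) - f ?g\<bar> < e / 2"
        using U(3) rescale_in_orthant by (simp add: dist_real_def)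
      moreover have "0 \<le> 2 * B / \<delta> * ?S \<beta> n"
        using B0 \<delta>(1) by (intro mult_nonneg_nonneg sum_nonneg) auto
      ultimately show ?thesis by linarith
    next
      case False
      then obtain k where k: "k \<in> {2..L}" "\<delta> \<le> \<bar>?x \<beta> n k - ?g k\<bar>" by force
      have "\<bar>?x \<beta> n k - ?g k\<bar> \<le> ?S \<beta> n"
        by (rule member_le_sum[OF k(1)]) auto
      with k have "\<delta> \<le> ?S \<beta> n" by linarith
      then have "2 * B / \<delta> * \<delta> \<le> 2 * B / \<delta> * ?S \<beta> n"
        using B0 \<delta>(1) by (intro mult_left_mono) auto
      moreover have "2 * B / \<delta> * \<delta> = 2 * B" using \<delta>(1) by simp
      moreover have "\<bar>f (?x \<beta> n) - f ?g\<bar> \<le> 2 * B"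
        using B[OF g] B[OF rescale_in_orthant, of \<beta> n] by linarith
      ultimately show ?thesis using e by linarith
    qed
    have "(\<lambda>\<beta>. 2 * B / \<delta> * (\<Sum>k=2..L. pos_err k \<beta> \<alpha>)) \<longlonglongrightarrow> 2 * B / \<delta> * (\<Sum>k=2..L. 0)"
      by (intro tendsto_mult_left tendsto_sum pos_err_tendsto[OF \<alpha>])
    then have "\<forall>\<^sub>F \<beta> in sequentially. 2 * B / \<delta> * (\<Sum>k=2..L. pos_err k \<beta> \<alpha>) < e / 2"
      using e by (intro order_tendstoD) auto
    then show "\<forall>\<^sub>F \<beta> in sequentially.
        dist (measure_pmf.expectation (p \<alpha> \<beta>) (\<lambda>n. f (?x \<beta> n))) (f ?g) < e"
      using eventually_ge_at_top[of 1]
    proof eventually_elim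
      case (elim \<beta>)
      have intf: "integrable (measure_pmf (p \<alpha> \<beta>)) (\<lambda>n. f (?x \<beta> n))"
        using B[OF rescale_in_orthant] by (intro bounded_integrable_pmf[where B=B])
      have intS: "integrable (measure_pmf (p \<alpha> \<beta>)) (?S \<beta>)"
        by (rule Bochner_Integration.integrable_sum) (rule integrable_pos_err[OF \<alpha> elim(2)])
      have ES: "measure_pmf.expectation (p \<alpha> \<beta>) (?S \<beta>) = (\<Sum>k=2..L. pos_err k \<beta> \<alpha>)"
        unfolding pos_err_def
        by (rule Bochner_Integration.integral_sum) (rule integrable_pos_err[OF \<alpha> elim(2)])
      have "\<bar>measure_pmf.expectation (p \<alpha> \<beta>) (\<lambda>n. f (?x \<beta> n)) - f ?g\<bar>
          = \<bar>measure_pmf.expectation (p \<alpha> \<beta>) (\<lambda>n. f (?x \<beta> n) - f ?g)\<bar>"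
        using intf by simp
      also have "\<dots> \<le> measure_pmf.expectation (p \<alpha> \<beta>) (\<lambda>n. \<bar>f (?x \<beta> n) - f ?g\<bar>)"
        by (rule integral_abs_bound)
      also have "\<dots> \<le> measure_pmf.expectation (p \<alpha> \<beta>) (\<lambda>n. e / 2 + 2 * B / \<delta> * ?S \<beta> n)"
        using intf intS by (intro integral_mono pw Bochner_Integration.integrable_add integrable_mult_right) auto
      also have "\<dots> = e / 2 + 2 * B / \<delta> * measure_pmf.expectation (p \<alpha> \<beta>) (?S \<beta>)"
        using intS by simp
      also note ES
      also have "e / 2 + 2 * B / \<delta> * (\<Sum>k=2..L. pos_err k \<beta> \<alpha>) < e" using elim(1) by linarith
      finally show ?case by (simp add: dist_real_def)
    qed
  qed
  moreover have "integral\<^sup>L (return (restrict_space borel (orthant L)) ?g) f = f ?g"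
    using g by (intro integral_return borel_measurable_continuous_on_restrict f) (simp add: space_restrict_space)
  ultimately show "(\<lambda>\<beta>. integral\<^sup>L (rescaled_law L a \<beta> (p \<alpha> \<beta>)) f)
      \<longlonglongrightarrow> integral\<^sup>L (return (restrict_space borel (orthant L)) ?g) f"
    by (simp add: integral_rescaled_law[OF f])
qed

lemma phi_bar_eq:
  assumes "\<alpha> \<in> {0..1}"
  shows "phi_bar L a p \<beta> \<alpha> = measure_pmf.expectation (p \<alpha> \<beta>) (\<lambda>n. theta0 \<alpha> (rescale L a \<beta> n) L)"
  unfolding phi_bar_def psi0_def
  by (rule integral_rescaled_law[OF continuous_on_theta0[OF assms]])

lemma phi_bar_nonneg: "\<alpha> \<in> {0..1} \<Longrightarrow> 0 \<le> phi_bar L a p \<beta> \<alpha>"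
  using theta0_rescale_bounds(1) by (auto simp: phi_bar_eq intro!: integral_nonneg_AE)

theorem uniform_limit_phi_bar:
  "uniform_limit {0..1} (phi_bar L a p) (phi_lim L \<rho>) sequentially"
proof -
  have "\<bar>phi_bar L a p \<beta> \<alpha> - phi_lim L \<rho> \<alpha>\<bar> \<le> theta_err L \<beta> \<alpha>" if \<alpha>: "\<alpha> \<in> {0..1}" for \<alpha> \<beta>
  proof -
    have "integrable (measure_pmf (p \<alpha> \<beta>)) (\<lambda>n. theta0 \<alpha> (rescale L a \<beta> n) L)"
      using theta0_rescale_bounds[OF \<alpha>] by (intro bounded_integrable_pmf[where B=1]) auto
    then have "phi_bar L a p \<beta> \<alpha> - phi_lim L \<rho> \<alpha>
        = measure_pmf.expectation (p \<alpha> \<beta>) (\<lambda>n. theta0 \<alpha> (rescale L a \<beta> n) L - phi_lim L \<rho> \<alpha>)"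
      by (simp add: phi_bar_eq[OF \<alpha>])
    then show ?thesis unfolding theta_err_def by (simp only: integral_abs_bound)
  qed
  then have "\<forall>\<^sub>F \<beta> in sequentially. \<forall>\<alpha>\<in>{0..1}. norm (phi_bar L a p \<beta> \<alpha> - phi_lim L \<rho> \<alpha>) \<le> theta_err L \<beta> \<alpha>"
    by (simp add: real_norm_def)
  moreover have "uniform_limit {0..1} (theta_err L) (\<lambda>_. 0) sequentially"
    using L by (intro uniform_limit_theta_err) auto
  ultimately have "uniform_limit {0..1} (\<lambda>\<beta> \<alpha>. phi_bar L a p \<beta> \<alpha> - phi_lim L \<rho> \<alpha>) (\<lambda>_. 0) sequentially"
    by (rule uniform_limit_null_comparison)
  then show ?thesis by (simp add: uniform_limit_iff dist_real_def)
qed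

text \<open>The upper estimate is the value at \<open>u = \<alpha>\<close>. For the lower one, \<open>phi_bar\<close> at \<open>u\<close> is uniformly close
to \<open>phi_lim\<close> at \<open>u\<close>, which is at least \<open>phi_lim\<close> at \<open>\<alpha>\<close>.\<close>

theorem INF_phi_bar_tendsto:
  assumes \<alpha>: "\<alpha> \<in> {0..1}"
  shows "(\<lambda>\<beta>. INF u\<in>{\<alpha>..1}. phi_bar L a p \<beta> u) \<longlonglongrightarrow> phi_lim L \<rho> \<alpha>"
proof (rule tendstoI)
  fix e :: real assume e: "0 < e"
  have "\<forall>\<^sub>F \<beta> in sequentially. \<forall>u\<in>{0..1}. dist (phi_bar L a p \<beta> u) (phi_lim L \<rho> u) < e / 2"
    using e by (intro uniform_limitD[OF uniform_limit_phi_bar]) simp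
  then show "\<forall>\<^sub>F \<beta> in sequentially. dist (INF u\<in>{\<alpha>..1}. phi_bar L a p \<beta> u) (phi_lim L \<rho> \<alpha>) < e"
  proof eventually_elim
    case (elim \<beta>)
    let ?I = "INF u\<in>{\<alpha>..1}. phi_bar L a p \<beta> u"
    have "bdd_below (phi_bar L a p \<beta> ` {\<alpha>..1})"
      using \<alpha> phi_bar_nonneg by (intro bdd_belowI[of _ 0]) auto
    then have "?I \<le> phi_bar L a p \<beta> \<alpha>"
      using \<alpha> by (intro cINF_lower) auto
    moreover have "phi_lim L \<rho> \<alpha> - e / 2 \<le> ?I"
    proof (rule cINF_greatest)
      fix u assume u: "u \<in> {\<alpha>..1}"
      then have "\<bar>phi_bar L a p \<beta> u - phi_lim L \<rho> u\<bar> < e / 2"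
        using elim \<alpha> by (simp add: dist_real_def)
      moreover have "phi_lim L \<rho> \<alpha> \<le> phi_lim L \<rho> u" using u by (intro phi_lim_mono) simp
      ultimately show "phi_lim L \<rho> \<alpha> - e / 2 \<le> phi_bar L a p \<beta> u" by linarith
    qed (use \<alpha> in auto)
    moreover have "\<bar>phi_bar L a p \<beta> \<alpha> - phi_lim L \<rho> \<alpha>\<bar> < e / 2"
      using elim \<alpha> by (simp add: dist_real_def)
    ultimately have "\<bar>?I - phi_lim L \<rho> \<alpha>\<bar> < e"
      using e unfolding abs_less_iff by linarith
    then show ?case by (simp add: dist_real_def)
  qed
qed

end

theorem proposition5:
  fixes L :: nat and lam mu a \<rho> :: "nat \<Rightarrow> real"
    and P :: "real \<Rightarrow> nat \<Rightarrow> real \<Rightarrow> (nat \<Rightarrow> nat) \<Rightarrow> (nat \<Rightarrow> nat) pmf"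
    and p :: "real \<Rightarrow> nat \<Rightarrow> (nat \<Rightarrow> nat) pmf"
  assumes "2 \<le> L"
    and "\<And>k. k \<in> {2..L} \<Longrightarrow> 0 < lam k"
    and "\<And>k. k \<in> {2..L} \<Longrightarrow> 0 < mu k"
    and "\<And>k. k \<in> {2..L} \<Longrightarrow> 0 < a k"
    and "\<And>k. k \<in> {2..L} \<Longrightarrow> \<rho> k = lam k / mu k"
    and "\<And>k. k \<in> {2..L} \<Longrightarrow> \<rho> k < 1"
    and "\<And>\<alpha> \<beta>. \<alpha> \<in> {0..1} \<Longrightarrow> 1 \<le> \<beta> \<Longrightarrow>
           jump_semigroup (states L) (jump_rate L lam mu a \<alpha> \<beta>) (P \<alpha> \<beta>)"
    and "\<And>\<alpha> \<beta>. \<alpha> \<in> {0..1} \<Longrightarrow> 1 \<le> \<beta> \<Longrightarrow>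
           stationary_distribution (states L) (P \<alpha> \<beta>) (p \<alpha> \<beta>)"
  shows "tight_on (orthant L)
           {rescaled_law L a \<beta> (p \<alpha> \<beta>) |\<alpha> \<beta>. \<alpha> \<in> {0..1} \<and> 1 \<le> \<beta>}
       \<and> (\<forall>\<alpha>\<in>{0..1}. weak_conv_on (orthant L) (\<lambda>\<beta>. rescaled_law L a \<beta> (p \<alpha> \<beta>))
            (return (restrict_space borel (orthant L)) (gamma_lim L \<rho> \<alpha>)))
       \<and> (\<forall>\<alpha>\<in>{0..1}. (\<lambda>\<beta>. phi_bar L a p \<beta> \<alpha>) \<longlonglongrightarrow> phi_lim L \<rho> \<alpha>)
       \<and> (\<forall>\<alpha>\<in>{0..1}. (\<lambda>\<beta>. INF u\<in>{\<alpha>..1}. phi_bar L a p \<beta> u) \<longlonglongrightarrow> phi_lim L \<rho> \<alpha>)"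
proof -
  interpret quasi_stationary_network L lam mu a \<rho> P p
    by unfold_locales (fact assms)+
  show ?thesis
    using tight_rescaled_laws rescaled_law_tendsto_dirac INF_phi_bar_tendsto
      tendsto_uniform_limitI[OF uniform_limit_phi_bar] by blast
qed

end
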